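(* Assume $\ell(w,z)\in[0,1]$ for all $w,z$. Define the random variables $\bar L^+_i=\ell(W,\widetilde{Z}^{i,0}_{1,\overline{U}^{i,0}_1})$ for $i\in[K]$ and $L^{i+}_j=\ell(W,\widetilde{Z}^{i,V_i}_{j,0})$ for $i\in[K]$, $j\in[n]$. Let constants $C_1,C_2>1$ and $C_3,C_4>0$ satisfy $e^{-2C_3C_1}+e^{2C_3}\le2$ and $e^{-2C_4C_2}+e^{2C_4}\le2$. Then $$\mathbb{E}[L_{\mathcal{D}}(W)]\le C_1C_2\,\mathbb{E}[L_S(W)]+\sum_{i=1}^K\frac{I(\bar L^+_i;V_i)}{C_3K}+\sum_{i=1}^K\sum_{j=1}^n\frac{C_1\,I(L^{i+}_j;U^{i,V_i}_j\mid V_i)}{C_4Kn}.$$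
   Context: Setting. $\mathcal{Z}$ is an instance space, $\mathcal{W}$ a hypothesis space, $\mathcal{C}$ a set of clients; each client $c\in\mathcal{C}$ has a data distribution $\mu_c$ on $\mathcal{Z}$, and $\mathcal{D}$ is a probability distribution on $\mathcal{C}$ (so a draw from $\mathcal{D}$ yields a data distribution on $\mathcal{Z}$). A loss $\ell:\mathcal{W}\times\mathcal{Z}\to[0,\infty)$ is given. There are $K$ participating clients, each with $n$ training points. A federated learning (FL) algorithm $\mathcal{A}$ is a conditional distribution $P_{W|S}$ mapping the collective training sample $S=(S_1,\dots,S_K)\in\mathcal{Z}^{nK}$ to a hypothesis $W\in\mathcal{W}$. Superclient/supersample construction. Let $\tilde\mu=(\tilde\mu_{i,b})_{i\in[K],b\in\{0,1\}}$ have i.i.d. entries drawn from $\mathcal{D}$. Conditionally on $\tilde\mu$, for each $(i,b)$ let $\widetilde{Z}^{i,b}=(\widetilde{Z}^{i,b}_{j,c})_{j\in[n],c\in\{0,1\}}$ have i.i.d. entries drawn from $\tilde\mu_{i,b}$, independently over $(i,b)$. Let $V=(V_1,\dots,V_K)$ and $U^{i,b}=(U^{i,b}_j)_{j\in[n]}$ ($i\in[K]$, $b\in\{0,1\}$) be mutually independent $\mathrm{Unif}\{0,1\}$ random variables, independent of $(\tilde\mu,\widetilde{Z})$. Write $\overline{V}_i=1-V_i$, $\overline{U}^{i,b}_j=1-U^{i,b}_j$. The $i$-th participating client distribution is $\mu_i=\tilde\mu_{i,V_i}$ and its training set is $S_i=(Z_{i,1},\dots,Z_{i,n})$ with $Z_{i,j}=\widetilde{Z}^{i,V_i}_{j,U^{i,V_i}_j}$;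 $S=(S_1,\dots,S_K)$. Given all of these variables, $W\sim P_{W|S}$. Risks. $L_{\mathcal{D}}(w)=\mathbb{E}_{\mu\sim\mathcal{D}}\mathbb{E}_{Z\sim\mu}\ell(w,Z)$; $L_S(w)=\frac{1}{Kn}\sum_{i=1}^K\sum_{j=1}^n\ell(w,Z_{i,j})$. $I(X;Y)$ and $I(X;Y|Z)$ denote mutual and conditional mutual information. *)

theory Defs
  imports "HOL-Probability.Probability"
begin

text \<open>Uniform bit on {0,1}; bits are encoded as bool (0 = False, 1 = True).\<close>
definition coin :: "bool measure" where
  "coin = measure_pmf (pmf_of_set UNIV)"

definition client_idx :: "nat \<Rightarrow> (nat \<times> bool) set" where
  "client_idx K = {..<K} \<times> (UNIV :: bool set)"

definition zt_idx :: "nat \<Rightarrow> nat \<Rightarrow> ((nat \<times> bool) \<times> (nat \<times> bool)) set" where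
  "zt_idx K n = client_idx K \<times> ({..<n} \<times> (UNIV :: bool set))"

definition u_idx :: "nat \<Rightarrow> nat \<Rightarrow> ((nat \<times> bool) \<times> nat) set" where
  "u_idx K n = client_idx K \<times> {..<n}"

definition fl_sample ::
  "nat \<Rightarrow> nat \<Rightarrow> (((nat \<times> bool) \<times> (nat \<times> bool)) \<Rightarrow> 'z) \<Rightarrow> (nat \<Rightarrow> bool)
     \<Rightarrow> (((nat \<times> bool) \<times> nat) \<Rightarrow> bool) \<Rightarrow> (nat \<times> nat \<Rightarrow> 'z)" where
  "fl_sample K n zt v u = (\<lambda>(i, j) \<in> {..<K} \<times> {..<n}. zt ((i, v i), (j, u ((i, v i), j))))"

definition fl_outcome_space ::
  "'c measure \<Rightarrow> 'z measure \<Rightarrow> 'w measure \<Rightarrow> nat \<Rightarrow> nat \<Rightarrow>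
   ((nat \<times> bool \<Rightarrow> 'c) \<times> ((nat \<times> bool) \<times> (nat \<times> bool) \<Rightarrow> 'z) \<times> (nat \<Rightarrow> bool)
     \<times> ((nat \<times> bool) \<times> nat \<Rightarrow> bool) \<times> 'w) measure" where
  "fl_outcome_space D MZ MW K n =
     PiM (client_idx K) (\<lambda>_. D) \<Otimes>\<^sub>M PiM (zt_idx K n) (\<lambda>_. MZ) \<Otimes>\<^sub>M
     PiM {..<K} (\<lambda>_. coin) \<Otimes>\<^sub>M PiM (u_idx K n) (\<lambda>_. coin) \<Otimes>\<^sub>M MW"

definition fl_joint ::
  "'c measure \<Rightarrow> ('c \<Rightarrow> 'z measure) \<Rightarrow> 'z measure \<Rightarrow> 'w measure
     \<Rightarrow> ((nat \<times> nat \<Rightarrow> 'z) \<Rightarrow> 'w measure) \<Rightarrow> nat \<Rightarrow> nat \<Rightarrow>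
   ((nat \<times> bool \<Rightarrow> 'c) \<times> ((nat \<times> bool) \<times> (nat \<times> bool) \<Rightarrow> 'z) \<times> (nat \<Rightarrow> bool)
     \<times> ((nat \<times> bool) \<times> nat \<Rightarrow> bool) \<times> 'w) measure" where
  "fl_joint D \<mu> MZ MW A K n =
     PiM (client_idx K) (\<lambda>_. D) \<bind> (\<lambda>mt.
     PiM (zt_idx K n) (\<lambda>((i, b), _). \<mu> (mt (i, b))) \<bind> (\<lambda>zt.
     PiM {..<K} (\<lambda>_. coin) \<bind> (\<lambda>v.
     PiM (u_idx K n) (\<lambda>_. coin) \<bind> (\<lambda>u.
     A (fl_sample K n zt v u) \<bind> (\<lambda>w.
     return (fl_outcome_space D MZ MW K n) (mt, zt, v, u, w))))))"

definition pop_risk :: "'c measure \<Rightarrow> ('c \<Rightarrow> 'z measure) \<Rightarrow> ('w \<Rightarrow> 'z \<Rightarrow> real) \<Rightarrow> 'w \<Rightarrow> real" where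
  "pop_risk D \<mu> loss w = (\<integral>c. (\<integral>z. loss w z \<partial>(\<mu> c)) \<partial>D)"

definition emp_risk :: "nat \<Rightarrow> nat \<Rightarrow> ('w \<Rightarrow> 'z \<Rightarrow> real) \<Rightarrow> 'w \<Rightarrow> (nat \<times> nat \<Rightarrow> 'z) \<Rightarrow> real" where
  "emp_risk K n loss w s = (1 / (real K * real n)) * (\<Sum>i<K. \<Sum>j<n. loss w (s (i, j)))"

end

(* The loss of an unseen point of a non-participating client, of an unseen point of a participating
   client, and of a training point have, conditionally on the bits (V, U), expectations that do not
   depend on the bits: the coordinates of the supersample are exchangeable. Hence, up to a factor 2, the
   gap "test - C1 * unseen" is the expectation of L * (1 if V_i = 1 else -C1) with L the loss of the
   fixed superclient (i, 0), and the gap "unseen - C2 * train" is likewise a contrast in the bit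
   U^{i,V_i}_j of the loss at the fixed column 0. The Donsker-Varadhan inequality bounds such an
   expectation of f(L, bit) by the mutual information as soon as the mean of exp f(l, bit) over a fair
   bit is at most 1 for every l; for l in [0,1] this follows by convexity from the condition on the
   constants at l = 1. *)
theory Submission
  imports Defs
begin

section \<open>Lower bounds for mutual information\<close>

text \<open>The loss variables have arbitrary laws, so no fixed measure on the reals supplies
  densities for them. Finiteness of the bits removes this obstacle: the joint law of a loss and a
  bit is dominated by the law of the loss times counting measure, and the density, being a
  conditional probability of the bit, lies between 0 and 1. Integrability then comes from bounds on
  a finite measure. The second obstacle is that the index of the bit U^{i,V_i}_j is itself random,
  while the joint law draws the bits after the supersample. Once the bits are moved to the outermost
  integral, the selection of training points is a fixed injective reindexing of a product measure.
  The 2 in the exponents of the assumptions compensates for the probability 1/2 of each bit value.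
  The product C1 * C2, and the C1 in front of the last sum, arise from inserting the
  unseen-to-training bound into the test-to-unseen bound.\<close>

lemma AE_density_le_1:
  fixes f :: "'a \<Rightarrow> ennreal"
  assumes "finite_measure M" and f[measurable]: "f \<in> borel_measurable M"
    and le: "\<And>A. A \<in> sets M \<Longrightarrow> emeasure (density M f) A \<le> emeasure M A"
  shows "AE x in M. f x \<le> 1"
proof -
  interpret finite_measure M by fact
  define B where "B = {x \<in> space M. 1 < f x}"
  have B[measurable]: "B \<in> sets M" unfolding B_def by measurable
  have fin: "(\<integral>\<^sup>+x. indicator B x \<partial>M) \<noteq> \<infinity>"
    using emeasure_finite[of B] by (subst nn_integral_indicator) auto
  \<comment> \<open>Subtraction in \<open>ennreal\<close> is cut off at 0, but on \<open>B\<close>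
    it is genuine. The integral is therefore the excess of \<open>density M f\<close> over
    \<open>M\<close> on \<open>B\<close>, which \<open>le\<close> forces to be 0.\<close>
  have "(\<integral>\<^sup>+x. (f x - 1) * indicator B x \<partial>M) = (\<integral>\<^sup>+x. f x * indicator B x - indicator B x \<partial>M)"
    by (intro nn_integral_cong) (auto simp: indicator_def)
  also have "\<dots> = (\<integral>\<^sup>+x. f x * indicator B x \<partial>M) - (\<integral>\<^sup>+x. indicator B x \<partial>M)"
    using fin by (intro nn_integral_diff) (simp_all add: indicator_def B_def less_imp_le)
  also have "\<dots> = 0"
    using le[OF B] emeasure_finite[of B]
    by (auto simp: emeasure_density less_top[symmetric] top_unique intro!: diff_eq_0_ennreal)
  finally have "AE x in M. (f x - 1) * indicator B x = 0"
    by (subst (asm) nn_integral_0_iff_AE) auto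
  then show ?thesis
    using AE_space
  proof eventually_elim
    case (elim x)
    then show ?case
      by (cases "x \<in> B") (auto simp: B_def not_less diff_eq_0_iff_ennreal)
  qed
qed

text \<open>For each of the finitely many y, dropping the condition Y = y can only enlarge the
  event, so the joint law is at most the law of \<open>X\<close> times counting measure, set by set.
  The density g(x, y) is the conditional probability of Y = y given X = x. Its bounds hold
  everywhere, not just almost everywhere, so that later estimates can be pointwise.\<close>

lemma (in prob_space) distributed_finite_bounded_density:
  fixes X :: "'a \<Rightarrow> 's" and Y :: "'a \<Rightarrow> 'y::finite"
  assumes [measurable]: "X \<in> M \<rightarrow>\<^sub>M S" "Y \<in> M \<rightarrow>\<^sub>M count_space UNIV"
  obtains g :: "'s \<times> 'y \<Rightarrow> real" where
    "g \<in> borel_measurable (distr M S X \<Otimes>\<^sub>M count_space UNIV)"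
    "\<And>x. 0 \<le> g x" "\<And>x. g x \<le> 1"
    "distributed M (distr M S X \<Otimes>\<^sub>M count_space UNIV) (\<lambda>x. (X x, Y x)) (\<lambda>x. ennreal (g x))"
proof -
  let ?N = "distr M S X"
  let ?P = "?N \<Otimes>\<^sub>M count_space (UNIV :: 'y set)"
  let ?Q = "distr M ?P (\<lambda>x. (X x, Y x))"
  interpret N: prob_space ?N by (rule prob_space_distr) simp
  interpret C: finite_measure "count_space (UNIV :: 'y set)" by (rule finite_measure_count_space) simp
  interpret P: pair_sigma_finite ?N "count_space (UNIV :: 'y set)" ..
  interpret P: finite_measure ?P by (intro finite_measure_pair_measure) unfold_locales
  have sets_P: "sets ?P = sets (S \<Otimes>\<^sub>M count_space UNIV)"
    by (intro sets_pair_measure_cong) auto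
  have le: "emeasure ?Q A \<le> emeasure ?P A" if A[measurable]: "A \<in> sets ?P" for A
  proof -
    have *: "(\<lambda>x. (x, y)) -` A \<inter> space S \<in> sets S" for y
      using A unfolding sets_P by measurable
    have "emeasure ?Q A = emeasure M ((\<lambda>x. (X x, Y x)) -` A \<inter> space M)"
      using A unfolding sets_P by (subst emeasure_distr) (simp_all add: sets_P cong: measurable_cong_sets)
    also have "\<dots> \<le> emeasure M (\<Union>y. X -` ((\<lambda>x. (x, y)) -` A \<inter> space S) \<inter> space M)"
      using measurable_space[OF assms(1)] * by (intro emeasure_mono) auto
    also have "\<dots> \<le> (\<Sum>y\<in>UNIV. emeasure M (X -` ((\<lambda>x. (x, y)) -` A \<inter> space S) \<inter> space M))"
      using * by (intro emeasure_subadditive_finite) auto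
    also have "\<dots> = (\<Sum>y\<in>UNIV. emeasure ?N ((\<lambda>x. (x, y)) -` A \<inter> space S))"
      using * by (intro sum.cong refl) (simp add: emeasure_distr)
    also have "\<dots> = emeasure ?P A"
    proof -
      have "A \<subseteq> space S \<times> UNIV" using sets.sets_into_space[OF A] by (auto simp: space_pair_measure)
      then have "(\<lambda>x. (x, y)) -` A \<inter> space S = (\<lambda>x. (x, y)) -` A" for y by auto
      then show ?thesis
        by (simp add: P.emeasure_pair_measure_alt2 nn_integral_count_space_finite)
    qed
    finally show ?thesis .
  qed
  have "absolutely_continuous ?P ?Q"
    unfolding absolutely_continuous_def
  proof
    fix A assume A: "A \<in> null_sets ?P"
    then show "A \<in> null_sets ?Q"
      using le[of A] null_setsD1[OF A] null_setsD2[OF A] by (intro null_setsI) auto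
  qed
  from P.Radon_Nikodym[OF this] obtain f where f[measurable]: "f \<in> borel_measurable ?P" and Q: "density ?P f = ?Q"
    by auto
  have ae: "AE x in ?P. f x \<le> 1"
    using le Q by (intro AE_density_le_1) (auto intro: P.finite_measure_axioms)
  \<comment> \<open>Cutting off at 1 alters the Radon-Nikodym derivative only on a null set and
    makes it a bounded real function.\<close>
  define g where "g x = enn2real (min 1 (f x))" for x
  have g1: "ennreal (g x) = min 1 (f x)" for x
    unfolding g_def by (subst ennreal_enn2real) (auto simp: min_less_iff_disj)
  have gm[measurable]: "g \<in> borel_measurable ?P" unfolding g_def by measurable
  have "density ?P f = density ?P (\<lambda>x. ennreal (g x))"
    using ae by (intro density_cong) (auto simp: g1 min_def)
  then have "distributed M ?P (\<lambda>x. (X x, Y x)) (\<lambda>x. ennreal (g x))"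
    unfolding distributed_def using Q by simp
  moreover have "g x \<le> 1" "0 \<le> g x" for x
  proof -
    show "0 \<le> g x" by (simp add: g_def)
    have "ennreal (g x) \<le> 1" unfolding g1 by simp
    then show "g x \<le> 1" by simp
  qed
  ultimately show thesis using gm that by blast
qed

lemma (in prob_space) distributed_finite_count_space:
  fixes Y :: "'a \<Rightarrow> 'y::finite"
  assumes [measurable]: "Y \<in> M \<rightarrow>\<^sub>M count_space UNIV"
  shows "distributed M (count_space UNIV) Y (\<lambda>y. ennreal (prob {\<omega> \<in> space M. Y \<omega> = y}))"
  unfolding distributed_def
proof (intro conjI)
  show "distr M (count_space UNIV) Y = density (count_space UNIV) (\<lambda>y. ennreal (prob {\<omega> \<in> space M. Y \<omega> = y}))"
    by (rule measure_eqI_countable[of _ UNIV])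
       (auto simp: emeasure_distr emeasure_density nn_integral_count_space_finite emeasure_eq_measure
             intro!: arg_cong[where f=prob])
qed auto

text \<open>Choosing the law of \<open>X\<close> as its own reference measure opens the density
  formulas for mutual information to an \<open>X\<close> of arbitrary law.\<close>

lemma (in prob_space) distributed_distr_self:
  assumes [measurable]: "X \<in> M \<rightarrow>\<^sub>M S"
  shows "distributed M (distr M S X) X (\<lambda>_. ennreal 1)"
  by (auto simp: distributed_def density_1 intro!: distr_cong)

text \<open>Integrated form of \<open>ln t \<ge> 1 - 1 / t\<close> at \<open>t = g / (q * exp f)\<close>.\<close>
lemma integral_ln_ratio_ge:
  fixes f g q :: "'a \<Rightarrow> real"
  assumes int: "integrable N (\<lambda>x. g x * ln (g x / q x))" "integrable N (\<lambda>x. g x * f x)"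
      "integrable N g" "integrable N (\<lambda>x. q x * exp (f x))"
    and nonneg: "\<And>x. 0 \<le> g x" "\<And>x. 0 \<le> q x" "\<And>x. q x = 0 \<Longrightarrow> g x = 0"
    and le: "(\<integral>x. q x * exp (f x) \<partial>N) \<le> (\<integral>x. g x \<partial>N)"
  shows "(\<integral>x. g x * f x \<partial>N) \<le> (\<integral>x. g x * ln (g x / q x) \<partial>N)"
proof -
  have pw: "g x * f x + (g x - q x * exp (f x)) \<le> g x * ln (g x / q x)" for x
  proof (cases "g x = 0")
    case True then show ?thesis using nonneg(2)[of x] by simp
  next
    case False
    then have pos: "0 < g x" "0 < q x" using nonneg[of x] by force+
    have "ln (q x * exp (f x) / g x) \<le> q x * exp (f x) / g x - 1"
      using pos by (intro ln_le_minus_one) auto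
    moreover have "ln (q x * exp (f x) / g x) = f x - ln (g x / q x)"
      using pos by (simp add: ln_mult ln_div)
    ultimately have "g x * (f x - ln (g x / q x)) \<le> g x * (q x * exp (f x) / g x - 1)"
      using pos by (intro mult_left_mono) auto
    then show ?thesis using pos by (simp add: algebra_simps)
  qed
  \<comment> \<open>The added difference of masses is nonnegative by \<open>le\<close>; it takes the
    place of normalising \<open>q * exp f\<close> to the mass of \<open>g\<close>.\<close>
  have "(\<integral>x. g x * f x \<partial>N) \<le> (\<integral>x. g x * f x \<partial>N) + ((\<integral>x. g x \<partial>N) - (\<integral>x. q x * exp (f x) \<partial>N))"
    using le by simp
  also have "\<dots> = (\<integral>x. g x * f x + (g x - q x * exp (f x)) \<partial>N)"
    using int by simp
  also have "\<dots> \<le> (\<integral>x. g x * ln (g x / q x) \<partial>N)"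
    using int pw by (intro integral_mono) auto
  finally show ?thesis .
qed

text \<open>On [0,1] each exponential lies below its chord, and the sum of the chords runs from the
  value 2 at l = 0 to the left side of the assumption at l = 1.\<close>

lemma exp_contrast_mean_le:
  fixes a b l :: real
  assumes "exp a + exp b \<le> 2" "0 \<le> l" "l \<le> 1"
  shows "exp (a * l) + exp (b * l) \<le> 2"
proof -
  have *: "exp (c * l) \<le> (1 - l) + l * exp c" for c :: real
    using convex_onD[OF exp_convex, of l 0 c] assms by (simp add: mult.commute)
  have "exp (a * l) + exp (b * l) \<le> 2 * (1 - l) + l * (exp a + exp b)"
    using *[of a] *[of b] by (simp add: algebra_simps)
  also have "\<dots> \<le> 2 * (1 - l) + l * 2"
    using assms by (intro add_left_mono mult_left_mono) auto
  finally show ?thesis by simp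
qed

section \<open>Mutual information with a finite-valued variable as an integral over the law of the
  other variable\<close>

lemma (in prob_space) mutual_information_sets_cong:
  assumes "sets S = sets S'"
  shows "mutual_information b S T X Y = mutual_information b S' T X Y"
  unfolding mutual_information_def
  using assms by (simp cong: distr_cong sets_pair_measure_cong)

text \<open>Both directions come from ln t <= t - 1, at t = 1 / g and at t = g. The bound is what
  makes the entropy integrands integrable.\<close>

lemma abs_mult_ln_le:
  fixes g c :: real
  assumes "0 \<le> g" "g \<le> c"
  shows "\<bar>g * ln g\<bar> \<le> 1 + c * c"
proof (cases "g = 0")
  case False
  then have g: "0 < g" using assms by simp
  have "ln (1 / g) \<le> 1 / g - 1"
    using g by (intro ln_le_minus_one) auto
  then have "g * - ln g \<le> g * (1 / g - 1)"
    using g by (intro mult_left_mono) (auto simp: ln_div)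
  then have "- (g * ln g) \<le> 1 - g" using g by (simp add: algebra_simps)
  moreover have "g * ln g \<le> g * c"
    using g assms ln_le_minus_one[of g] by (intro mult_left_mono) auto
  moreover have "g * c \<le> c * c"
    using g assms by (intro mult_right_mono) auto
  moreover have "0 \<le> c * c" by simp
  ultimately show ?thesis using g by linarith
qed simp

text \<open>The bound \<open>c\<close> is left general because a density obtained by summing out a
  finite variable is bounded below only by the number of its values. Positivity of \<open>p\<close>
  on a finite set keeps \<open>ln p\<close> bounded, hence the integrand as well.\<close>

lemma (in prob_space) mutual_information_finite_density:
  fixes S :: "'s measure" and X :: "'a \<Rightarrow> 's" and Y :: "'a \<Rightarrow> 'y::finite" and g :: "'s \<times> 'y \<Rightarrow> real"
  defines "N \<equiv> distr M S X \<Otimes>\<^sub>M count_space UNIV"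
    and "p \<equiv> \<lambda>y. prob {\<omega> \<in> space M. Y \<omega> = y}"
  assumes [measurable]: "X \<in> M \<rightarrow>\<^sub>M S" "Y \<in> M \<rightarrow>\<^sub>M count_space UNIV"
    and g[measurable]: "g \<in> borel_measurable N"
    and g0: "\<And>x. 0 \<le> g x" and gc: "\<And>x. g x \<le> c"
    and D: "distributed M N (\<lambda>x. (X x, Y x)) (\<lambda>x. ennreal (g x))"
    and pos: "\<And>y. 0 < p y"
  shows "integrable N (\<lambda>x. g x * ln (g x / p (snd x)))" (is ?int)
    and "mutual_information (exp 1) S (count_space UNIV) X Y = (\<integral>x. g x * ln (g x / p (snd x)) \<partial>N)" (is ?eq)
proof -
  interpret information_space M "exp 1" by standard simp
  interpret N: prob_space "distr M S X" by (rule prob_space_distr) simp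
  interpret C: finite_measure "count_space (UNIV :: 'y set)" by (rule finite_measure_count_space) simp
  interpret P: finite_measure N unfolding N_def by (intro finite_measure_pair_measure) unfold_locales
  have [measurable]: "(\<lambda>x. p (snd x)) \<in> borel_measurable N" unfolding N_def by measurable
  have "mutual_information (exp 1) S (count_space UNIV) X Y
      = mutual_information (exp 1) (distr M S X) (count_space UNIV) X Y"
    by (rule mutual_information_sets_cong) simp
  then show ?eq
    using mutual_information_distr[OF _ _ distributed_distr_self _ distributed_finite_count_space _ D[unfolded N_def]]
    by (simp add: p_def N_def g0 log_def N.sigma_finite_measure_axioms C.sigma_finite_measure_axioms)
  define b where "b = Max (range (\<lambda>y. \<bar>ln (p y)\<bar>))"
  have b: "\<bar>ln (p y)\<bar> \<le> b" for y unfolding b_def by (intro Max_ge) auto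
  have c0: "0 \<le> c" using order_trans[OF g0 gc] .
  have "\<bar>g x * ln (g x / p (snd x))\<bar> \<le> 1 + c * c + c * b" for x
  proof -
    have "g x * ln (g x / p (snd x)) = g x * ln (g x) - g x * ln (p (snd x))"
      using g0[of x] pos[of "snd x"] by (cases "g x = 0") (auto simp: ln_div algebra_simps)
    moreover have "\<bar>g x * ln (p (snd x))\<bar> \<le> c * b"
      unfolding abs_mult using g0[of x] gc[of x] b[of "snd x"] by (intro mult_mono) auto
    ultimately show ?thesis
      using abs_mult_ln_le[OF g0[of x] gc[of x]] by linarith
  qed
  then show ?int
    by (intro P.integrable_const_bound[of _ "1 + c * c + c * b"]) auto
qed

text \<open>This is the variational bound with reference density p(y), the density of the product of
  the two marginal laws. Since \<open>exp_le\<close> holds for each x separately, integrating it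
  gives the required normalisation whatever the law of \<open>X\<close> is.\<close>

lemma (in prob_space) expectation_le_mutual_information:
  fixes X :: "'a \<Rightarrow> 's" and Y :: "'a \<Rightarrow> 'y::finite" and f :: "'s \<times> 'y \<Rightarrow> real"
  assumes [measurable]: "X \<in> M \<rightarrow>\<^sub>M S" "Y \<in> M \<rightarrow>\<^sub>M count_space UNIV"
    "f \<in> borel_measurable (S \<Otimes>\<^sub>M count_space UNIV)"
    and bound: "\<And>x. \<bar>f x\<bar> \<le> B"
    and pos: "\<And>y. 0 < prob {\<omega> \<in> space M. Y \<omega> = y}"
    and exp_le: "\<And>x. (\<Sum>y\<in>UNIV. prob {\<omega> \<in> space M. Y \<omega> = y} * exp (f (x, y))) \<le> 1"
  shows "expectation (\<lambda>\<omega>. f (X \<omega>, Y \<omega>)) \<le> mutual_information (exp 1) S (count_space UNIV) X Y"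
proof -
  let ?S = "distr M S X"
  let ?N = "?S \<Otimes>\<^sub>M count_space (UNIV :: 'y set)"
  define p where "p y = prob {\<omega> \<in> space M. Y \<omega> = y}" for y
  interpret N: prob_space ?S by (rule prob_space_distr) simp
  interpret C: finite_measure "count_space (UNIV :: 'y set)" by (rule finite_measure_count_space) simp
  interpret P: pair_sigma_finite ?S "count_space (UNIV :: 'y set)" ..
  interpret P: finite_measure ?N by (intro finite_measure_pair_measure) unfold_locales
  obtain g where g[measurable]: "g \<in> borel_measurable ?N"
    and g0: "\<And>x. 0 \<le> g x" and g1: "\<And>x. g x \<le> 1"
    and D: "distributed M ?N (\<lambda>x. (X x, Y x)) (\<lambda>x. ennreal (g x))"
    by (rule distributed_finite_bounded_density[of X S Y]) auto
  have f[measurable]: "f \<in> borel_measurable ?N"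
    using assms(3) by (simp cong: measurable_cong_sets sets_pair_measure_cong)
  have p[simp]: "0 < p y" "p y \<le> 1" for y using pos[of y] by (auto simp: p_def)
  have [measurable]: "(\<lambda>x. p (snd x)) \<in> borel_measurable ?N" by measurable
  note MI = mutual_information_finite_density[OF assms(1,2) g g0 g1 D pos, folded p_def]
  have E: "expectation (\<lambda>\<omega>. h (X \<omega>, Y \<omega>)) = (\<integral>x. g x * h x \<partial>?N)"
    if "h \<in> borel_measurable ?N" for h :: "_ \<Rightarrow> real"
    using distributed_integral[OF D that] g0 by simp
  have int: "integrable ?N h" if "h \<in> borel_measurable ?N" "\<And>x. \<bar>h x\<bar> \<le> c" for h :: "_ \<Rightarrow> real" and c
    using that by (intro P.integrable_const_bound[of _ c]) auto
  have "(\<integral>x. g x * f x \<partial>?N) \<le> (\<integral>x. g x * ln (g x / p (snd x)) \<partial>?N)"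
  proof (rule integral_ln_ratio_ge)
    have "\<bar>g x * f x\<bar> \<le> 1 * B" for x
      unfolding abs_mult using g0[of x] g1[of x] bound[of x] by (intro mult_mono) auto
    then show "integrable ?N (\<lambda>x. g x * f x)"
      by (intro int) auto
    show "integrable ?N g"
      using g0 g1 by (intro int[of _ 1]) auto
    have ef: "exp (f x) \<le> exp B" for x using bound[of x] by (simp add: abs_le_iff)
    have "\<bar>p (snd x) * exp (f x)\<bar> \<le> 1 * exp B" for x
      unfolding abs_mult using ef[of x] by (intro mult_mono) (auto simp: abs_of_pos)
    then show int': "integrable ?N (\<lambda>x. p (snd x) * exp (f x))"
      by (intro int) auto
    have "(\<integral>x. p (snd x) * exp (f x) \<partial>?N) = (\<integral>x. (\<Sum>y\<in>UNIV. p y * exp (f (x, y))) \<partial>?S)"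
      using P.integral_fst'[OF int'] by (simp add: lebesgue_integral_count_space_finite)
    also have "\<dots> \<le> (\<integral>x. 1 \<partial>?S)"
    proof (rule integral_mono)
      show "integrable ?S (\<lambda>x. (\<Sum>y\<in>UNIV. p y * exp (f (x, y))))"
        using P.integrable_fst'[OF int'] by (simp add: lebesgue_integral_count_space_finite)
    qed (use exp_le in \<open>auto simp: p_def\<close>)
    also have "\<dots> = (\<integral>x. g x \<partial>?N)"
      using E[of "\<lambda>_. 1"] N.prob_space prob_space by simp
    finally show "(\<integral>x. p (snd x) * exp (f x) \<partial>?N) \<le> (\<integral>x. g x \<partial>?N)" .
  qed (use g0 MI(1) in \<open>auto simp: less_imp_le less_imp_neq[symmetric]\<close>)
  then show ?thesis unfolding MI(2) E[OF f] .
qed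

text \<open>Conditional mutual information is the chain-rule difference I(X; (Y, Z)) - I(X; Z). It
  is rewritten as the single integral of g ln (g / q), where q(x, y, z) = P(Z = z | X = x) P(Y = y |
  Z = z) is the density of the law that makes X and Y independent given Z and keeps the laws of (X,
  Z) and (Y, Z). The variational inequality is then applied with this \<open>q\<close>.\<close>

lemma (in prob_space) expectation_le_conditional_mutual_information:
  fixes X :: "'a \<Rightarrow> 's" and Y :: "'a \<Rightarrow> 'y::finite" and Z :: "'a \<Rightarrow> 'z::finite"
    and f :: "'s \<times> 'y \<times> 'z \<Rightarrow> real"
  assumes [measurable]: "X \<in> M \<rightarrow>\<^sub>M S" "Y \<in> M \<rightarrow>\<^sub>M count_space UNIV" "Z \<in> M \<rightarrow>\<^sub>M count_space UNIV"
    "f \<in> borel_measurable (S \<Otimes>\<^sub>M count_space UNIV)"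
    and bound: "\<And>x. \<bar>f x\<bar> \<le> B"
    and pos: "\<And>y z. 0 < prob {\<omega> \<in> space M. Y \<omega> = y \<and> Z \<omega> = z}"
    and exp_le: "\<And>x z. (\<Sum>y\<in>UNIV. prob {\<omega> \<in> space M. Y \<omega> = y \<and> Z \<omega> = z} * exp (f (x, y, z)))
        \<le> prob {\<omega> \<in> space M. Z \<omega> = z}"
  shows "expectation (\<lambda>\<omega>. f (X \<omega>, Y \<omega>, Z \<omega>))
    \<le> conditional_mutual_information (exp 1) S (count_space UNIV) (count_space UNIV) X Y Z"
proof -
  let ?S = "distr M S X"
  let ?N = "?S \<Otimes>\<^sub>M count_space (UNIV :: ('y \<times> 'z) set)"
  let ?N' = "?S \<Otimes>\<^sub>M count_space (UNIV :: 'z set)"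
  define p where "p yz = prob {\<omega> \<in> space M. (Y \<omega>, Z \<omega>) = yz}" for yz
  define pz where "pz z = prob {\<omega> \<in> space M. Z \<omega> = z}" for z
  have count_UNIV: "count_space (UNIV :: 'y set) \<Otimes>\<^sub>M count_space (UNIV :: 'z set) = count_space UNIV"
    by (simp add: pair_measure_count_space)
  have YZ[measurable]: "(\<lambda>\<omega>. (Y \<omega>, Z \<omega>)) \<in> M \<rightarrow>\<^sub>M count_space UNIV"
    unfolding count_UNIV[symmetric] by measurable
  interpret N: prob_space ?S by (rule prob_space_distr) simp
  interpret C: finite_measure "count_space (UNIV :: ('y \<times> 'z) set)" by (rule finite_measure_count_space) simp
  interpret C': finite_measure "count_space (UNIV :: 'z set)" by (rule finite_measure_count_space) simp
  interpret P: pair_sigma_finite ?S "count_space (UNIV :: ('y \<times> 'z) set)" ..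
  interpret P: finite_measure ?N by (intro finite_measure_pair_measure) unfold_locales
  interpret P': pair_sigma_finite ?S "count_space (UNIV :: 'z set)" ..
  obtain g where g[measurable]: "g \<in> borel_measurable ?N"
    and g0: "\<And>x. 0 \<le> g x" and g1: "\<And>x. g x \<le> 1"
    and D: "distributed M ?N (\<lambda>x. (X x, Y x, Z x)) (\<lambda>x. ennreal (g x))"
    by (rule distributed_finite_bounded_density[of X S "\<lambda>\<omega>. (Y \<omega>, Z \<omega>)"]) auto
  \<comment> \<open>Summing out y gives the density of (X, Z); each summand is at most 1, whence the
    bound by the number \<open>c\<close> of values of y.\<close>
  define gz where "gz xz = (\<Sum>y\<in>UNIV. g (fst xz, y, snd xz))" for xz
  define c where "c = real CARD('y)"
  have "(\<lambda>xz. (fst xz, y, snd xz)) \<in> ?N' \<rightarrow>\<^sub>M ?N" for y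
    unfolding count_UNIV[symmetric] by measurable
  then have gz[measurable]: "gz \<in> borel_measurable ?N'"
    unfolding gz_def by (intro borel_measurable_sum measurable_compose[OF _ g])
  have gz0: "0 \<le> gz x" and gz1: "gz x \<le> c" for x
    unfolding gz_def c_def using sum_mono[of UNIV "\<lambda>y. g (fst x, y, snd x)" "\<lambda>_. 1"]
    by (auto intro!: sum_nonneg simp: g0 g1)
  have proj[measurable]: "(\<lambda>x. (fst x, snd (snd x))) \<in> ?N \<rightarrow>\<^sub>M ?N'"
    unfolding count_UNIV[symmetric] by measurable
  have Dz: "distributed M ?N' (\<lambda>x. (X x, Z x)) (\<lambda>x. ennreal (gz x))"
    unfolding distributed_def
  proof (intro conjI)
    have "distr M ?N' (\<lambda>x. (X x, Z x)) = distr (distr M ?N (\<lambda>x. (X x, Y x, Z x))) ?N' (\<lambda>x. (fst x, snd (snd x)))"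
      using distributed_measurable[OF D] by (subst distr_distr) (auto simp: comp_def)
    also have "\<dots> = distr (density ?N g) ?N' (\<lambda>x. (fst x, snd (snd x)))"
      using D by (simp add: distributed_def)
    also have "\<dots> = density ?N' gz"
    proof (rule measure_eqI)
      fix A assume "A \<in> sets (distr (density ?N g) ?N' (\<lambda>x. (fst x, snd (snd x))))"
      then have A[measurable]: "A \<in> sets ?N'" by simp
      have "emeasure (distr (density ?N g) ?N' (\<lambda>x. (fst x, snd (snd x)))) A
          = (\<integral>\<^sup>+x. ennreal (g x) * indicator A (fst x, snd (snd x)) \<partial>?N)"
        by (subst emeasure_distr) (auto simp: emeasure_density indicator_def intro!: nn_integral_cong)
      also have "\<dots> = (\<integral>\<^sup>+x. (\<Sum>(y, z)\<in>UNIV. ennreal (g (x, y, z)) * indicator A (x, z)) \<partial>?S)"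
        by (subst C.nn_integral_fst[symmetric])
           (simp_all add: nn_integral_count_space_finite case_prod_unfold)
      also have "\<dots> = (\<integral>\<^sup>+x. (\<Sum>z\<in>UNIV. ennreal (gz (x, z)) * indicator A (x, z)) \<partial>?S)"
        unfolding UNIV_Times_UNIV[symmetric]
        by (intro nn_integral_cong, subst sum.cartesian_product[symmetric], subst sum.swap)
           (simp add: gz_def sum_distrib_right[symmetric] sum_ennreal g0)
      also have "\<dots> = (\<integral>\<^sup>+x. ennreal (gz x) * indicator A x \<partial>?N')"
        by (subst C'.nn_integral_fst[symmetric])
           (auto simp: nn_integral_count_space_finite intro!: nn_integral_cong)
      also have "\<dots> = emeasure (density ?N' gz) A"
        by (simp add: emeasure_density)
      finally show "emeasure (distr (density ?N g) ?N' (\<lambda>x. (fst x, snd (snd x)))) A = emeasure (density ?N' gz) A" .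
    qed simp
    finally show "distr M ?N' (\<lambda>x. (X x, Z x)) = density ?N' gz" .
  qed auto
  have f[measurable]: "f \<in> borel_measurable ?N"
    using assms(4) by (simp cong: measurable_cong_sets sets_pair_measure_cong)
  have p[simp]: "0 < p y" "p y \<le> 1" for y using pos by (cases y; auto simp: p_def)+
  have p_le: "p (y, z) \<le> pz z" for y z
    unfolding p_def pz_def by (intro finite_measure_mono) auto
  have pz[simp]: "0 < pz z" "pz z \<le> 1" for z
    using less_le_trans[OF p(1) p_le[of undefined z]] by (auto simp: pz_def)
  have [measurable]: "(\<lambda>x. p (snd x)) \<in> borel_measurable ?N" "(\<lambda>x. pz (snd x)) \<in> borel_measurable ?N'"
    "(\<lambda>x. pz (snd (snd x))) \<in> borel_measurable ?N" by measurable
  have [measurable]: "(\<lambda>x. gz (fst x, snd (snd x))) \<in> borel_measurable ?N"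
    using measurable_compose[OF proj gz] .
  note MI = mutual_information_finite_density[OF assms(1) YZ g g0 g1 D, folded p_def, OF p(1)]
  note MIz = mutual_information_finite_density[OF assms(1,3) gz gz0 gz1 Dz, folded pz_def, OF pz(1)]
  have E: "expectation (\<lambda>\<omega>. h (X \<omega>, Y \<omega>, Z \<omega>)) = (\<integral>x. g x * h x \<partial>?N)"
    if "h \<in> borel_measurable ?N" for h :: "_ \<Rightarrow> real"
    using distributed_integral[OF D that] g0 by simp
  let ?h = "\<lambda>xz. ln (gz xz / pz (snd xz))"
  \<comment> \<open>Both sides are the expectation of the same function of (X, Z). This puts I(X; Z)
    on the space of I(X; (Y, Z)), so that the two can be subtracted under one integral.\<close>
  have Ez: "(\<integral>x. gz x * ?h x \<partial>?N') = (\<integral>x. g x * ?h (fst x, snd (snd x)) \<partial>?N)"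
    using distributed_integral[OF Dz, of ?h] gz0 E[of "\<lambda>x. ?h (fst x, snd (snd x))"] by simp
  have intz: "integrable ?N (\<lambda>x. g x * ?h (fst x, snd (snd x)))"
    using distributed_integrable[OF Dz, of ?h] gz0 g0 MIz(1)
      distributed_integrable[OF D, of "\<lambda>x. ?h (fst x, snd (snd x))"] by simp
  define q where "q x = gz (fst x, snd (snd x)) * (p (snd x) / pz (snd (snd x)))" for x
  have [measurable]: "q \<in> borel_measurable ?N" unfolding q_def by measurable
  have q0: "0 \<le> q x" for x using gz0 p pz by (simp add: q_def less_imp_le)
  have qc: "q x \<le> c" for x
  proof -
    have "p (snd x) / pz (snd (snd x)) \<le> 1"
      using p_le[of "fst (snd x)" "snd (snd x)"] pz(1) by (simp add: divide_le_eq_1_pos)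
    then have "q x \<le> c * 1" unfolding q_def
      using gz0 gz1 p pz by (intro mult_mono) (auto intro: order_trans[OF gz0 gz1] simp: less_imp_le)
    then show ?thesis by simp
  qed
  \<comment> \<open>This yields the absolute continuity required by the variational inequality:
    \<open>p\<close> and \<open>pz\<close> are positive, so q = 0 forces gz = 0 and hence g =
    0.\<close>
  have g_le_gz: "g x \<le> gz (fst x, snd (snd x))" for x
    unfolding gz_def using member_le_sum[of "fst (snd x)" UNIV "\<lambda>y. g (fst x, y, snd (snd x))"] g0 by simp
  have qz: "g x = 0" if "q x = 0" for x
    using that p(1)[of "snd x"] pz(1)[of "snd (snd x)"] g0[of x] g_le_gz[of x] by (simp add: q_def)
  have ln_q: "g x * ln (g x / p (snd x)) - g x * ?h (fst x, snd (snd x)) = g x * ln (g x / q x)" for x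
  proof (cases "g x = 0")
    case False
    then have "0 < g x" "0 < gz (fst x, snd (snd x))"
      using g0[of x] g_le_gz[of x] by linarith+
    then show ?thesis
      by (simp add: q_def ln_div ln_mult algebra_simps less_imp_neq[OF p(1), symmetric] less_imp_neq[OF pz(1), symmetric])
  qed simp
  have CMI: "conditional_mutual_information (exp 1) S (count_space UNIV) (count_space UNIV) X Y Z
      = (\<integral>x. g x * ln (g x / q x) \<partial>?N)"
    unfolding conditional_mutual_information_def count_UNIV MI(2) MIz(2) Ez ln_q[symmetric]
    by (rule Bochner_Integration.integral_diff[OF MI(1) intz, symmetric])
  have int: "integrable ?N h" if "h \<in> borel_measurable ?N" "\<And>x. \<bar>h x\<bar> \<le> c" for h :: "_ \<Rightarrow> real" and c
    using that by (intro P.integrable_const_bound[of _ c]) auto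
  have "(\<integral>x. g x * f x \<partial>?N) \<le> (\<integral>x. g x * ln (g x / q x) \<partial>?N)"
  proof (rule integral_ln_ratio_ge)
    have "\<bar>g x * f x\<bar> \<le> 1 * B" for x
      unfolding abs_mult using g0[of x] g1[of x] bound[of x] by (intro mult_mono) auto
    then show "integrable ?N (\<lambda>x. g x * f x)"
      by (intro int) auto
    show int_g: "integrable ?N g"
      using g0 g1 by (intro int[of _ 1]) auto
    show "integrable ?N (\<lambda>x. g x * ln (g x / q x))"
      unfolding ln_q[symmetric] using MI(1) intz by simp
    have ef: "exp (f x) \<le> exp B" for x using bound[of x] by (simp add: abs_le_iff)
    have "\<bar>q x * exp (f x)\<bar> \<le> c * exp B" for x
      unfolding abs_mult using q0[of x] qc[of x] ef[of x] by (intro mult_mono) auto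
    then show int': "integrable ?N (\<lambda>x. q x * exp (f x))"
      by (intro int) auto
    \<comment> \<open>Grouping by z exposes the inner sum over y that \<open>exp_le\<close> bounds
      by P(Z = z); the denominator \<open>pz z\<close> then cancels and leaves the mass of
      \<open>gz\<close>.\<close>
    have eq: "(\<Sum>yz\<in>UNIV. q (x, yz) * exp (f (x, yz)))
        = (\<Sum>z\<in>UNIV. gz (x, z) / pz z * (\<Sum>y\<in>UNIV. p (y, z) * exp (f (x, y, z))))" for x
      unfolding UNIV_Times_UNIV[symmetric]
      by (subst sum.cartesian_product', subst sum.swap)
         (simp add: q_def sum_distrib_left mult_ac divide_simps)
    have le: "(\<Sum>yz\<in>UNIV. q (x, yz) * exp (f (x, yz))) \<le> (\<Sum>yz\<in>UNIV. g (x, yz))" for x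
    proof -
      have "gz (x, z) / pz z * (\<Sum>y\<in>UNIV. p (y, z) * exp (f (x, y, z))) \<le> gz (x, z) / pz z * pz z" for z
        using gz0 pz(1)[of z] exp_le[of z x] by (intro mult_left_mono) (auto simp: p_def pz_def)
      then have "(\<Sum>yz\<in>UNIV. q (x, yz) * exp (f (x, yz))) \<le> (\<Sum>z\<in>UNIV. gz (x, z))"
        unfolding eq using pz(1) by (intro sum_mono) (simp add: less_imp_neq[symmetric])
      also have "\<dots> = (\<Sum>yz\<in>UNIV. g (x, yz))"
        unfolding UNIV_Times_UNIV[symmetric]
        by (subst sum.cartesian_product', subst sum.swap) (simp add: gz_def)
      finally show ?thesis .
    qed
    have "(\<integral>x. q x * exp (f x) \<partial>?N) = (\<integral>x. (\<Sum>yz\<in>UNIV. q (x, yz) * exp (f (x, yz))) \<partial>?S)"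
      using P.integral_fst'[OF int'] by (simp add: lebesgue_integral_count_space_finite)
    also have "\<dots> \<le> (\<integral>x. (\<Sum>yz\<in>UNIV. g (x, yz)) \<partial>?S)"
      using P.integrable_fst'[OF int'] P.integrable_fst'[OF int_g] le
      by (intro integral_mono) (simp_all add: lebesgue_integral_count_space_finite)
    also have "\<dots> = (\<integral>x. g x \<partial>?N)"
      using P.integral_fst'[OF int_g] by (simp add: lebesgue_integral_count_space_finite)
    finally show "(\<integral>x. q x * exp (f x) \<partial>?N) \<le> (\<integral>x. g x \<partial>?N)" .
  qed (use g0 q0 qz in auto)
  then show ?thesis unfolding CMI E[OF f] .
qed

section \<open>Products of kernels and of coins\<close>

text \<open>It suffices to test measurability on cylinder sets, an intersection-stable generator;
  there the product measure is a finite product of measurable functions.\<close>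

lemma measurable_PiM_kernel:
  assumes k: "\<And>i. i \<in> I \<Longrightarrow> k i \<in> N \<rightarrow>\<^sub>M prob_algebra (M i)"
  shows "(\<lambda>x. \<Pi>\<^sub>M i\<in>I. k i x) \<in> N \<rightarrow>\<^sub>M prob_algebra (\<Pi>\<^sub>M i\<in>I. M i)"
proof (rule measurable_prob_algebra_generated[OF sets_PiM Int_stable_prod_algebra prod_algebra_sets_into_space])
  fix x assume x: "x \<in> space N"
  have kx: "prob_space (k i x)" "sets (k i x) = sets (M i)" if "i \<in> I" for i
    using measurable_space[OF k[OF that] x] by (auto simp: space_prob_algebra)
  show "prob_space (\<Pi>\<^sub>M i\<in>I. k i x)"
    by (intro prob_space_PiM kx)
  show "sets (\<Pi>\<^sub>M i\<in>I. k i x) = sets (\<Pi>\<^sub>M i\<in>I. M i)"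
    by (intro sets_PiM_cong kx refl)
next
  fix A assume "A \<in> prod_algebra I M"
  then obtain J E where A: "A = prod_emb I M J (Pi\<^sub>E J E)"
    and J: "finite J" "J \<subseteq> I" and E: "\<And>i. i \<in> J \<Longrightarrow> E i \<in> sets (M i)"
    by (rule prod_algebraE) auto
  have "emeasure (\<Pi>\<^sub>M i\<in>I. k i x) A = (\<Prod>i\<in>J. emeasure (k i x) (E i))" if x: "x \<in> space N" for x
  proof -
    have kx: "prob_space (k i x)" "sets (k i x) = sets (M i)" if "i \<in> I" for i
      using measurable_space[OF k[OF that] x] by (auto simp: space_prob_algebra)
    have "A = prod_emb I (\<lambda>i. k i x) J (Pi\<^sub>E J E)"
      unfolding A prod_emb_def using PiE_cong[OF sets_eq_imp_space_eq[OF kx(2)], of I] by simp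
    then show ?thesis
      using J E kx by (auto intro!: emeasure_PiM_emb)
  qed
  then show "(\<lambda>x. emeasure (\<Pi>\<^sub>M i\<in>I. k i x) A) \<in> borel_measurable N"
  proof (subst measurable_cong)
    show "(\<lambda>x. \<Prod>i\<in>J. emeasure (k i x) (E i)) \<in> borel_measurable N"
      using J E k by (intro borel_measurable_prod_ennreal measurable_emeasure_kernel measurable_prob_algebraD) auto
  qed auto
qed

lemma distr_PiM_pair_reindex:
  assumes M: "\<And>i. i \<in> I \<Longrightarrow> prob_space (M i)"
    and f: "inj_on f J" "f \<in> J \<rightarrow> I" and x: "x \<in> I" "x \<notin> f ` J"
  shows "distr (\<Pi>\<^sub>M i\<in>I. M i) (M x \<Otimes>\<^sub>M (\<Pi>\<^sub>M j\<in>J. M (f j))) (\<lambda>\<omega>. (\<omega> x, \<lambda>j\<in>J. \<omega> (f j)))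
    = M x \<Otimes>\<^sub>M (\<Pi>\<^sub>M j\<in>J. M (f j))"
proof -
  let ?R = "I - {x}"
  let ?P = "M x \<Otimes>\<^sub>M (\<Pi>\<^sub>M i\<in>?R. M i)"
  let ?Q = "M x \<Otimes>\<^sub>M (\<Pi>\<^sub>M j\<in>J. M (f j))"
  have I: "insert x ?R = I" using x by auto
  have fR: "f \<in> J \<rightarrow> ?R" using f x by auto
  have meas_comp[measurable]: "(\<lambda>\<omega>. \<lambda>j\<in>J. \<omega> (f j)) \<in> (\<Pi>\<^sub>M i\<in>L. M i) \<rightarrow>\<^sub>M (\<Pi>\<^sub>M j\<in>J. M (f j))"
    if "f \<in> J \<rightarrow> L" for L
    using that by (intro measurable_restrict measurable_component_singleton) auto
  have upd: "(\<lambda>(z, X). X(x := z)) \<in> ?P \<rightarrow>\<^sub>M (\<Pi>\<^sub>M i\<in>I. M i)"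
    unfolding case_prod_beta using x
    by (intro measurable_fun_upd[where J="?R"]) auto
  have "distr (\<Pi>\<^sub>M i\<in>I. M i) ?Q (\<lambda>\<omega>. (\<omega> x, \<lambda>j\<in>J. \<omega> (f j)))
      = distr (distr ?P (\<Pi>\<^sub>M i\<in>I. M i) (\<lambda>(z, X). X(x := z))) ?Q (\<lambda>\<omega>. (\<omega> x, \<lambda>j\<in>J. \<omega> (f j)))"
    using distr_pair_PiM_eq_PiM[of ?R M x, unfolded I] M x(1) by simp
  also have "\<dots> = distr ?P ?Q ((\<lambda>\<omega>. (\<omega> x, \<lambda>j\<in>J. \<omega> (f j))) \<circ> (\<lambda>(z, X). X(x := z)))"
    using upd meas_comp[OF f(2)] x by (intro distr_distr) auto
  \<comment> \<open>Overwriting coordinate \<open>x\<close> does not affect the family, because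
    \<open>f\<close> maps into the remaining indices.\<close>
  also have "\<dots> = distr ?P ?Q (\<lambda>(z, X). (z, \<lambda>j\<in>J. X (f j)))"
    using fR by (intro distr_cong refl) (auto simp: fun_eq_iff restrict_def)
  also have "\<dots> = distr (M x) (M x) (\<lambda>z. z) \<Otimes>\<^sub>M distr (\<Pi>\<^sub>M i\<in>?R. M i) (\<Pi>\<^sub>M j\<in>J. M (f j)) (\<lambda>X. \<lambda>j\<in>J. X (f j))"
    using meas_comp[OF fR] M f
    by (intro pair_measure_distr[symmetric] prob_space_imp_sigma_finite prob_space.prob_space_distr prob_space_PiM) auto
  also have "\<dots> = ?Q"
    using distr_PiM_reindex[OF _ f(1) fR, of M] M by simp
  finally show ?thesis .
qed

section \<open>Fair coins\<close>

lemma sets_coin[measurable_cong, simp]: "sets coin = sets (count_space UNIV)"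
  by (simp add: coin_def)

lemma measurable_coin: "N \<rightarrow>\<^sub>M coin = N \<rightarrow>\<^sub>M count_space UNIV"
  by (rule measurable_cong_sets) auto

lemma prob_space_coin: "prob_space coin"
  unfolding coin_def by (rule prob_space_measure_pmf)

lemma emeasure_coin_singleton: "emeasure coin {b} = ennreal (1 / 2)"
  by (simp add: coin_def emeasure_pmf_single)

lemma emeasure_PiM_coin:
  assumes "x \<in> I"
  shows "emeasure (\<Pi>\<^sub>M i\<in>I. coin) {v \<in> space (\<Pi>\<^sub>M i\<in>I. coin). v x = b} = ennreal (1 / 2)"
proof -
  have "emeasure (\<Pi>\<^sub>M i\<in>I. coin) {v \<in> space (\<Pi>\<^sub>M i\<in>I. coin). v x = b} = emeasure (distr (\<Pi>\<^sub>M i\<in>I. coin) coin (\<lambda>v. v x)) {b}"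
    using assms by (subst emeasure_distr) (auto intro!: arg_cong[where f="emeasure _"])
  also have "\<dots> = ennreal (1 / 2)"
    using distr_PiM_component[of I "\<lambda>_. coin" x] assms by (simp add: prob_space_coin emeasure_coin_singleton)
  finally show ?thesis .
qed

lemma integral_diff_scaled:
  fixes f g :: "'a \<Rightarrow> real"
  assumes "integrable M f" "integrable M g"
  shows "(\<integral>x. a * f x - b * g x \<partial>M) = a * (\<integral>x. f x \<partial>M) - b * (\<integral>x. g x \<partial>M)"
  using assms by simp

text \<open>For each pair (i, j) the sample gap bounds \<open>U i\<close>; multiplied by
  \<open>C1\<close> and inserted into the client gap, it eliminates \<open>U i\<close> and bounds
  the constant \<open>T\<close>. Averaging over all pairs gives the claim.\<close>

lemma average_gap_bound:
  fixes T C1 C2 C3 C4 :: real and U I :: "nat \<Rightarrow> real" and R J :: "nat \<Rightarrow> nat \<Rightarrow> real"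
  assumes pos: "0 < K" "0 < n" "0 \<le> C1" "0 < C3" "0 < C4"
    and client: "\<And>i. i < K \<Longrightarrow> C3 * (T - C1 * U i) \<le> I i"
    and sample: "\<And>i j. i < K \<Longrightarrow> j < n \<Longrightarrow> C4 * (U i - C2 * R i j) \<le> J i j"
  shows "T \<le> C1 * C2 * ((1 / (real K * real n)) * (\<Sum>i<K. \<Sum>j<n. R i j))
    + (\<Sum>i<K. I i / (C3 * real K)) + (\<Sum>i<K. \<Sum>j<n. C1 * J i j / (C4 * real K * real n))"
proof -
  have pointwise: "T \<le> C1 * C2 * R i j + I i / C3 + C1 * J i j / C4" if "i < K" "j < n" for i j
  proof -
    have "T \<le> C1 * U i + I i / C3"
      using client[OF that(1)] pos by (simp add: field_simps)
    moreover have "U i \<le> C2 * R i j + J i j / C4"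
      using sample[OF that] pos by (simp add: field_simps)
    then have "C1 * U i \<le> C1 * (C2 * R i j + J i j / C4)"
      using pos by (intro mult_left_mono)
    ultimately show ?thesis by (simp add: algebra_simps)
  qed
  have "real K * real n * T = (\<Sum>i<K. \<Sum>j<n. T)" by simp
  also have "\<dots> \<le> (\<Sum>i<K. \<Sum>j<n. C1 * C2 * R i j + I i / C3 + C1 * J i j / C4)"
    using pointwise by (intro sum_mono) auto
  finally have "T \<le> (\<Sum>i<K. \<Sum>j<n. C1 * C2 * R i j + I i / C3 + C1 * J i j / C4) / (real K * real n)"
    using pos by (simp add: pos_le_divide_eq mult.commute)
  \<comment> \<open>The division by \<open>real n\<close> is kept separate on the client term: that
    term does not depend on j, so summation over j cancels the division.\<close>
  also have "\<dots> = (\<Sum>i<K. \<Sum>j<n. C1 * C2 * (1 / (real K * real n) * R i j) + I i / (C3 * real K) / real n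
      + C1 * J i j / (C4 * real K * real n))"
    unfolding sum_divide_distrib by (intro sum.cong refl) (simp add: add_divide_distrib)
  also have "\<dots> = C1 * C2 * ((1 / (real K * real n)) * (\<Sum>i<K. \<Sum>j<n. R i j))
      + (\<Sum>i<K. I i / (C3 * real K)) + (\<Sum>i<K. \<Sum>j<n. C1 * J i j / (C4 * real K * real n))"
    using pos by (simp add: sum.distrib flip: sum_distrib_left sum_divide_distrib)
  finally show ?thesis .
qed

section \<open>The joint law with the bits drawn first\<close>

locale fl_setting =
  fixes D :: "'c measure" and \<mu> :: "'c \<Rightarrow> 'z measure" and MZ :: "'z measure"
    and MW :: "'w measure" and A :: "(nat \<times> nat \<Rightarrow> 'z) \<Rightarrow> 'w measure"
    and K n :: nat
  assumes prob_D: "prob_space D"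
    and \<mu>[measurable]: "\<mu> \<in> D \<rightarrow>\<^sub>M prob_algebra MZ"
    and A[measurable]: "A \<in> PiM ({..<K} \<times> {..<n}) (\<lambda>_. MZ) \<rightarrow>\<^sub>M prob_algebra MW"
begin

abbreviation "PC \<equiv> PiM (client_idx K) (\<lambda>_. D)"
abbreviation "PZ \<equiv> PiM (zt_idx K n) (\<lambda>_. MZ)"
abbreviation "PV \<equiv> PiM {..<K} (\<lambda>_. coin)"
abbreviation "PU \<equiv> PiM (u_idx K n) (\<lambda>_. coin)"
abbreviation "PS \<equiv> PiM ({..<K} \<times> {..<n}) (\<lambda>_. MZ)"
abbreviation "\<Omega> \<equiv> fl_outcome_space D MZ MW K n"
abbreviation "joint \<equiv> fl_joint D \<mu> MZ MW A K n"

definition "zt_kernel mt = PiM (zt_idx K n) (\<lambda>((i, b), _). \<mu> (mt (i, b)))"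
text \<open>Law of the training sample given the K selected clients. The bits no longer occur in it,
  which is how exchangeability of the supersample is expressed.\<close>

definition "sample_kernel m = PiM ({..<K} \<times> {..<n}) (\<lambda>(i, j). \<mu> (m i))"

section \<open>Measurability of the kernels and of lookups at random indices\<close>

lemma zt_kernel[measurable]: "zt_kernel \<in> PC \<rightarrow>\<^sub>M prob_algebra PZ"
  unfolding zt_kernel_def case_prod_beta
  by (rule measurable_PiM_kernel) (auto simp: zt_idx_def)

lemma sample_kernel[measurable]: "sample_kernel \<in> PiM {..<K} (\<lambda>_. D) \<rightarrow>\<^sub>M prob_algebra PS"
  unfolding sample_kernel_def case_prod_beta
  by (rule measurable_PiM_kernel) auto

text \<open>An index that depends on two random bits takes only four values, so the lookup is a case
  distinction between fixed coordinates.\<close>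

lemma measurable_zt_lookup[measurable (raw)]:
  assumes [measurable]: "zt \<in> N \<rightarrow>\<^sub>M PZ" "Measurable.pred N b" "Measurable.pred N c" and "i < K" "j < n"
  shows "(\<lambda>\<omega>. zt \<omega> ((i, b \<omega>), (j, c \<omega>))) \<in> N \<rightarrow>\<^sub>M MZ"
proof -
  have [measurable]: "(\<lambda>\<omega>. zt \<omega> ((i, b'), (j, c'))) \<in> N \<rightarrow>\<^sub>M MZ" for b' c'
    using assms by (intro measurable_compose[OF assms(1) measurable_component_singleton])
       (auto simp: zt_idx_def client_idx_def)
  have "(\<lambda>\<omega>. zt \<omega> ((i, b \<omega>), (j, c \<omega>))) = (\<lambda>\<omega>.
      if b \<omega> then (if c \<omega> then zt \<omega> ((i, True), (j, True)) else zt \<omega> ((i, True), (j, False)))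
      else (if c \<omega> then zt \<omega> ((i, False), (j, True)) else zt \<omega> ((i, False), (j, False))))"
    by (auto simp: fun_eq_iff)
  then show ?thesis by simp
qed

lemma measurable_u_lookup[measurable (raw)]:
  assumes [measurable]: "u \<in> N \<rightarrow>\<^sub>M PU" "Measurable.pred N b" and "i < K" "j < n"
  shows "Measurable.pred N (\<lambda>\<omega>. u \<omega> ((i, b \<omega>), j))"
proof -
  have "(\<lambda>\<omega>. u \<omega> ((i, b'), j)) \<in> N \<rightarrow>\<^sub>M coin" for b'
    using assms by (intro measurable_compose[OF assms(1) measurable_component_singleton])
       (auto simp: u_idx_def client_idx_def)
  then have [measurable]: "Measurable.pred N (\<lambda>\<omega>. u \<omega> ((i, b'), j))" for b'
    by (simp add: measurable_coin)
  have "(\<lambda>\<omega>. u \<omega> ((i, b \<omega>), j)) = (\<lambda>\<omega>. if b \<omega> then u \<omega> ((i, True), j) else u \<omega> ((i, False), j))"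
    by (auto simp: fun_eq_iff)
  then show ?thesis by simp
qed

lemma measurable_v_lookup[measurable (raw)]:
  assumes "v \<in> N \<rightarrow>\<^sub>M PV" "i < K"
  shows "Measurable.pred N (\<lambda>\<omega>. v \<omega> i)"
proof -
  have "(\<lambda>\<omega>. v \<omega> i) \<in> N \<rightarrow>\<^sub>M coin"
    using assms by (intro measurable_compose[OF assms(1) measurable_component_singleton]) auto
  then show ?thesis by (simp add: measurable_coin)
qed

lemma measurable_fl_sample[measurable (raw)]:
  assumes [measurable]: "zt \<in> N \<rightarrow>\<^sub>M PZ" "v \<in> N \<rightarrow>\<^sub>M PV" "u \<in> N \<rightarrow>\<^sub>M PU"
  shows "(\<lambda>\<omega>. fl_sample K n (zt \<omega>) (v \<omega>) (u \<omega>)) \<in> N \<rightarrow>\<^sub>M PS"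
  unfolding fl_sample_def case_prod_beta
  by (rule measurable_restrict) auto

lemma prob_space_PV: "prob_space PV" and prob_space_PU: "prob_space PU" and prob_space_PC: "prob_space PC"
  by (auto intro!: prob_space_PiM prob_space_coin prob_D)

lemma in_prob_algebra[measurable]:
  "PV \<in> space (prob_algebra PV)" "PU \<in> space (prob_algebra PU)" "PC \<in> space (prob_algebra PC)"
  by (auto simp: space_prob_algebra prob_space_PV prob_space_PU prob_space_PC)

text \<open>The nested binds of the joint law can be unfolded into integrals only along measurable
  kernels. They are obtained from the innermost draw outward, each stage taking all earlier draws as
  arguments.\<close>

lemma outcome_kernel[measurable]:
  "(\<lambda>(mt, zt, v, u). A (fl_sample K n zt v u) \<bind> (\<lambda>w. return \<Omega> (mt, zt, v, u, w)))
    \<in> PC \<Otimes>\<^sub>M PZ \<Otimes>\<^sub>M PV \<Otimes>\<^sub>M PU \<rightarrow>\<^sub>M prob_algebra \<Omega>"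
  unfolding case_prod_beta
proof (rule measurable_bind_prob_space2)
  show "(\<lambda>x. A (fl_sample K n (fst (snd x)) (fst (snd (snd x))) (snd (snd (snd x)))))
      \<in> PC \<Otimes>\<^sub>M PZ \<Otimes>\<^sub>M PV \<Otimes>\<^sub>M PU \<rightarrow>\<^sub>M prob_algebra MW"
    by measurable
  show "(\<lambda>(x, w). return \<Omega> (fst x, fst (snd x), fst (snd (snd x)), snd (snd (snd x)), w))
      \<in> (PC \<Otimes>\<^sub>M PZ \<Otimes>\<^sub>M PV \<Otimes>\<^sub>M PU) \<Otimes>\<^sub>M MW \<rightarrow>\<^sub>M prob_algebra \<Omega>"
    unfolding case_prod_beta
    by (rule measurable_compose[OF _ measurable_return_prob_space]) (simp add: fl_outcome_space_def)
qed

lemma measurable_const_kernel: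
  "(\<lambda>_. PV) \<in> N \<rightarrow>\<^sub>M prob_algebra PV" "(\<lambda>_. PU) \<in> N \<rightarrow>\<^sub>M prob_algebra PU"
  by (auto intro!: measurable_const in_prob_algebra)

lemma outcome_kernel3[measurable]:
  "(\<lambda>(mt, zt, v). PU \<bind> (\<lambda>u. A (fl_sample K n zt v u) \<bind> (\<lambda>w. return \<Omega> (mt, zt, v, u, w))))
    \<in> PC \<Otimes>\<^sub>M PZ \<Otimes>\<^sub>M PV \<rightarrow>\<^sub>M prob_algebra \<Omega>"
  unfolding case_prod_beta
proof (rule measurable_bind_prob_space2[OF measurable_const_kernel(2)])
  have "(\<lambda>(x, u). (fst x, fst (snd x), snd (snd x), u))
      \<in> (PC \<Otimes>\<^sub>M PZ \<Otimes>\<^sub>M PV) \<Otimes>\<^sub>M PU \<rightarrow>\<^sub>M PC \<Otimes>\<^sub>M PZ \<Otimes>\<^sub>M PV \<Otimes>\<^sub>M PU"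
    by measurable
  from measurable_compose[OF this outcome_kernel]
  show "(\<lambda>(x, u). A (fl_sample K n (fst (snd x)) (snd (snd x)) u)
        \<bind> (\<lambda>w. return \<Omega> (fst x, fst (snd x), snd (snd x), u, w)))
      \<in> (PC \<Otimes>\<^sub>M PZ \<Otimes>\<^sub>M PV) \<Otimes>\<^sub>M PU \<rightarrow>\<^sub>M prob_algebra \<Omega>"
    by (simp add: case_prod_beta)
qed

lemma outcome_kernel2[measurable]:
  "(\<lambda>(mt, zt). PV \<bind> (\<lambda>v. PU \<bind> (\<lambda>u. A (fl_sample K n zt v u) \<bind> (\<lambda>w. return \<Omega> (mt, zt, v, u, w)))))
    \<in> PC \<Otimes>\<^sub>M PZ \<rightarrow>\<^sub>M prob_algebra \<Omega>"
  unfolding case_prod_beta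
proof (rule measurable_bind_prob_space2[OF measurable_const_kernel(1)])
  have "(\<lambda>(x, v). (fst x, snd x, v)) \<in> (PC \<Otimes>\<^sub>M PZ) \<Otimes>\<^sub>M PV \<rightarrow>\<^sub>M PC \<Otimes>\<^sub>M PZ \<Otimes>\<^sub>M PV"
    by measurable
  from measurable_compose[OF this outcome_kernel3]
  show "(\<lambda>(x, v). PU \<bind> (\<lambda>u. A (fl_sample K n (snd x) v u) \<bind> (\<lambda>w. return \<Omega> (fst x, snd x, v, u, w))))
      \<in> (PC \<Otimes>\<^sub>M PZ) \<Otimes>\<^sub>M PV \<rightarrow>\<^sub>M prob_algebra \<Omega>"
    by (simp add: case_prod_beta)
qed

lemma outcome_kernel1[measurable]:
  "(\<lambda>mt. zt_kernel mt \<bind> (\<lambda>zt. PV \<bind> (\<lambda>v. PU \<bind> (\<lambda>u. A (fl_sample K n zt v u)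
      \<bind> (\<lambda>w. return \<Omega> (mt, zt, v, u, w))))))
    \<in> PC \<rightarrow>\<^sub>M prob_algebra \<Omega>"
  by (rule measurable_bind_prob_space2[OF zt_kernel outcome_kernel2])

lemma joint_in_prob_algebra: "joint \<in> space (prob_algebra \<Omega>)"
  using measurable_space[OF measurable_bind_prob_space[OF measurable_const[OF in_prob_algebra(3)] outcome_kernel1], of _ "count_space UNIV"]
  by (simp add: fl_joint_def zt_kernel_def[symmetric])

lemma prob_space_joint: "prob_space joint"
  and sets_joint[measurable_cong]: "sets joint = sets \<Omega>"
  using joint_in_prob_algebra by (auto simp: space_prob_algebra)

section \<open>The joint law as an iterated integral\<close>

lemma nn_integral_joint:
  assumes F[measurable]: "F \<in> borel_measurable \<Omega>"
  shows "(\<integral>\<^sup>+x. F x \<partial>joint) = (\<integral>\<^sup>+mt. \<integral>\<^sup>+zt. \<integral>\<^sup>+v. \<integral>\<^sup>+u. \<integral>\<^sup>+w. F (mt, zt, v, u, w)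
      \<partial>A (fl_sample K n zt v u) \<partial>PU \<partial>PV \<partial>zt_kernel mt \<partial>PC)"
proof -
  note kD = measurable_prob_algebraD
  have "(\<integral>\<^sup>+x. F x \<partial>joint) = (\<integral>\<^sup>+mt. \<integral>\<^sup>+x. F x \<partial>(zt_kernel mt \<bind> (\<lambda>zt. PV \<bind> (\<lambda>v. PU \<bind> (\<lambda>u.
      A (fl_sample K n zt v u) \<bind> (\<lambda>w. return \<Omega> (mt, zt, v, u, w)))))) \<partial>PC)"
    unfolding fl_joint_def zt_kernel_def[symmetric]
    by (rule nn_integral_bind[OF F kD[OF outcome_kernel1]])
  also have "\<dots> = (\<integral>\<^sup>+mt. \<integral>\<^sup>+zt. \<integral>\<^sup>+x. F x \<partial>(PV \<bind> (\<lambda>v. PU \<bind> (\<lambda>u.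
      A (fl_sample K n zt v u) \<bind> (\<lambda>w. return \<Omega> (mt, zt, v, u, w))))) \<partial>zt_kernel mt \<partial>PC)"
  proof (intro nn_integral_cong)
    fix mt assume mt: "mt \<in> space PC"
    note s[measurable_cong] = sets_kernel[OF kD[OF zt_kernel] mt]
    have "(\<lambda>zt. (mt, zt)) \<in> zt_kernel mt \<rightarrow>\<^sub>M PC \<Otimes>\<^sub>M PZ" using mt by measurable
    from kD[OF measurable_compose[OF this outcome_kernel2]]
    show "(\<integral>\<^sup>+x. F x \<partial>(zt_kernel mt \<bind> (\<lambda>zt. PV \<bind> (\<lambda>v. PU \<bind> (\<lambda>u.
        A (fl_sample K n zt v u) \<bind> (\<lambda>w. return \<Omega> (mt, zt, v, u, w))))))) =
        (\<integral>\<^sup>+zt. \<integral>\<^sup>+x. F x \<partial>(PV \<bind> (\<lambda>v. PU \<bind> (\<lambda>u.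
        A (fl_sample K n zt v u) \<bind> (\<lambda>w. return \<Omega> (mt, zt, v, u, w))))) \<partial>zt_kernel mt)"
      by (intro nn_integral_bind[OF F]) simp
  qed
  also have "\<dots> = (\<integral>\<^sup>+mt. \<integral>\<^sup>+zt. \<integral>\<^sup>+v. \<integral>\<^sup>+u. \<integral>\<^sup>+w. F (mt, zt, v, u, w)
      \<partial>A (fl_sample K n zt v u) \<partial>PU \<partial>PV \<partial>zt_kernel mt \<partial>PC)"
  proof (intro nn_integral_cong)
    fix mt zt assume mt[measurable]: "mt \<in> space PC" and "zt \<in> space (zt_kernel mt)"
    then have zt[measurable]: "zt \<in> space PZ"
      using sets_eq_imp_space_eq[OF sets_kernel[OF kD[OF zt_kernel] mt]] by simp
    have "(\<lambda>v. (mt, zt, v)) \<in> PV \<rightarrow>\<^sub>M PC \<Otimes>\<^sub>M PZ \<Otimes>\<^sub>M PV" by measurable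
    from kD[OF measurable_compose[OF this outcome_kernel3]]
    have "(\<integral>\<^sup>+x. F x \<partial>(PV \<bind> (\<lambda>v. PU \<bind> (\<lambda>u.
        A (fl_sample K n zt v u) \<bind> (\<lambda>w. return \<Omega> (mt, zt, v, u, w)))))) =
        (\<integral>\<^sup>+v. \<integral>\<^sup>+x. F x \<partial>(PU \<bind> (\<lambda>u.
        A (fl_sample K n zt v u) \<bind> (\<lambda>w. return \<Omega> (mt, zt, v, u, w)))) \<partial>PV)"
      by (intro nn_integral_bind[OF F]) simp
    also have "\<dots> = (\<integral>\<^sup>+v. \<integral>\<^sup>+u. \<integral>\<^sup>+x. F x
        \<partial>(A (fl_sample K n zt v u) \<bind> (\<lambda>w. return \<Omega> (mt, zt, v, u, w))) \<partial>PU \<partial>PV)"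
    proof (intro nn_integral_cong)
      fix v assume v[measurable]: "v \<in> space PV"
      have "(\<lambda>u. (mt, zt, v, u)) \<in> PU \<rightarrow>\<^sub>M PC \<Otimes>\<^sub>M PZ \<Otimes>\<^sub>M PV \<Otimes>\<^sub>M PU" by measurable
      from kD[OF measurable_compose[OF this outcome_kernel]]
      show "(\<integral>\<^sup>+x. F x \<partial>(PU \<bind> (\<lambda>u. A (fl_sample K n zt v u) \<bind> (\<lambda>w. return \<Omega> (mt, zt, v, u, w))))) =
          (\<integral>\<^sup>+u. \<integral>\<^sup>+x. F x \<partial>(A (fl_sample K n zt v u) \<bind> (\<lambda>w. return \<Omega> (mt, zt, v, u, w))) \<partial>PU)"
        by (intro nn_integral_bind[OF F]) simp
    qed
    also have "\<dots> = (\<integral>\<^sup>+v. \<integral>\<^sup>+u. \<integral>\<^sup>+w. F (mt, zt, v, u, w) \<partial>A (fl_sample K n zt v u) \<partial>PU \<partial>PV)"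
    proof (intro nn_integral_cong)
      fix v u assume v: "v \<in> space PV" and u: "u \<in> space PU"
      have "fl_sample K n zt v u \<in> space PS"
        using measurable_space[OF measurable_fl_sample[of "\<lambda>_. zt" "count_space UNIV" "\<lambda>_. v" "\<lambda>_. u"]] zt v u
        by auto
      note s[measurable_cong] = sets_kernel[OF kD[OF A] this]
      have T[measurable]: "(\<lambda>w. (mt, zt, v, u, w)) \<in> A (fl_sample K n zt v u) \<rightarrow>\<^sub>M \<Omega>"
        unfolding fl_outcome_space_def using mt zt v u by measurable
      have "(\<integral>\<^sup>+x. F x \<partial>(A (fl_sample K n zt v u) \<bind> (\<lambda>w. return \<Omega> (mt, zt, v, u, w))))
          = (\<integral>\<^sup>+w. \<integral>\<^sup>+x. F x \<partial>return \<Omega> (mt, zt, v, u, w) \<partial>A (fl_sample K n zt v u))"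
        by (intro nn_integral_bind[OF F] measurable_compose[OF T return_measurable])
      also have "\<dots> = (\<integral>\<^sup>+w. F (mt, zt, v, u, w) \<partial>A (fl_sample K n zt v u))"
        using measurable_space[OF T] by (intro nn_integral_cong nn_integral_return F) auto
      finally show "(\<integral>\<^sup>+x. F x \<partial>(A (fl_sample K n zt v u) \<bind> (\<lambda>w. return \<Omega> (mt, zt, v, u, w))))
          = (\<integral>\<^sup>+w. F (mt, zt, v, u, w) \<partial>A (fl_sample K n zt v u))" .
    qed
    finally show "(\<integral>\<^sup>+x. F x \<partial>(PV \<bind> (\<lambda>v. PU \<bind> (\<lambda>u.
        A (fl_sample K n zt v u) \<bind> (\<lambda>w. return \<Omega> (mt, zt, v, u, w)))))) =
        (\<integral>\<^sup>+v. \<integral>\<^sup>+u. \<integral>\<^sup>+w. F (mt, zt, v, u, w) \<partial>A (fl_sample K n zt v u) \<partial>PU \<partial>PV)" .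
  qed
  finally show ?thesis .
qed

text \<open>The law of the bits depends on neither superclients nor supersample, so Tonelli moves
  their integral outside both. With the bits fixed, the indices of the selected clients and points
  become constants.\<close>

lemma nn_integral_joint_bits_first:
  assumes F[measurable]: "F \<in> borel_measurable \<Omega>"
  shows "(\<integral>\<^sup>+x. F x \<partial>joint) = (\<integral>\<^sup>+(v, u). \<integral>\<^sup>+mt. \<integral>\<^sup>+zt. \<integral>\<^sup>+w. F (mt, zt, v, u, w)
      \<partial>A (fl_sample K n zt v u) \<partial>zt_kernel mt \<partial>PC \<partial>(PV \<Otimes>\<^sub>M PU))"
proof -
  note kD = measurable_prob_algebraD
  interpret V: prob_space PV by (rule prob_space_PV)
  interpret U: prob_space PU by (rule prob_space_PU)
  interpret C: prob_space PC by (rule prob_space_PC)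
  interpret VU: pair_prob_space PV PU ..
  interpret CVU: pair_prob_space PC "PV \<Otimes>\<^sub>M PU" ..
  \<comment> \<open>The law of \<open>w\<close> depends on the points and on the bits, so its
    integral has to stay innermost; the exchanges concern only the other draws.\<close>
  define G where "G = (\<lambda>(mt, zt, v, u). \<integral>\<^sup>+w. F (mt, zt, v, u, w) \<partial>A (fl_sample K n zt v u))"
  have F'[measurable]: "F \<in> borel_measurable (PC \<Otimes>\<^sub>M PZ \<Otimes>\<^sub>M PV \<Otimes>\<^sub>M PU \<Otimes>\<^sub>M MW)"
    using F by (simp add: fl_outcome_space_def)
  have G[measurable]: "G \<in> borel_measurable (PC \<Otimes>\<^sub>M PZ \<Otimes>\<^sub>M PV \<Otimes>\<^sub>M PU)"
    unfolding G_def case_prod_beta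
    by (rule nn_integral_measurable_subprob_algebra2[where N=MW]) (measurable; fail | intro kD; measurable)+
  have "(\<integral>\<^sup>+x. F x \<partial>joint) = (\<integral>\<^sup>+mt. \<integral>\<^sup>+zt. \<integral>\<^sup>+v. \<integral>\<^sup>+u. G (mt, zt, v, u) \<partial>PU \<partial>PV \<partial>zt_kernel mt \<partial>PC)"
    by (simp add: nn_integral_joint[OF F] G_def)
  also have "\<dots> = (\<integral>\<^sup>+mt. \<integral>\<^sup>+zt. \<integral>\<^sup>+x. G (mt, zt, x) \<partial>(PV \<Otimes>\<^sub>M PU) \<partial>zt_kernel mt \<partial>PC)"
  proof (intro nn_integral_cong)
    fix mt zt assume mt: "mt \<in> space PC" and "zt \<in> space (zt_kernel mt)"
    then have zt: "zt \<in> space PZ"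
      using sets_eq_imp_space_eq[OF sets_kernel[OF kD[OF zt_kernel] mt]] by simp
    have "(\<lambda>x. G (mt, zt, x)) \<in> borel_measurable (PV \<Otimes>\<^sub>M PU)" using mt zt by measurable
    from U.nn_integral_fst[OF this]
    show "(\<integral>\<^sup>+v. \<integral>\<^sup>+u. G (mt, zt, v, u) \<partial>PU \<partial>PV) = (\<integral>\<^sup>+x. G (mt, zt, x) \<partial>(PV \<Otimes>\<^sub>M PU))" .
  qed
  also have "\<dots> = (\<integral>\<^sup>+mt. \<integral>\<^sup>+x. \<integral>\<^sup>+zt. G (mt, zt, x) \<partial>zt_kernel mt \<partial>(PV \<Otimes>\<^sub>M PU) \<partial>PC)"
  proof (intro nn_integral_cong)
    fix mt assume mt: "mt \<in> space PC"
    note s[measurable_cong] = sets_kernel[OF kD[OF zt_kernel] mt]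
    interpret Z: prob_space "zt_kernel mt"
      using measurable_space[OF zt_kernel mt] by (simp add: space_prob_algebra)
    interpret Z: pair_prob_space "PV \<Otimes>\<^sub>M PU" "zt_kernel mt" ..
    show "(\<integral>\<^sup>+zt. \<integral>\<^sup>+x. G (mt, zt, x) \<partial>(PV \<Otimes>\<^sub>M PU) \<partial>zt_kernel mt)
        = (\<integral>\<^sup>+x. \<integral>\<^sup>+zt. G (mt, zt, x) \<partial>zt_kernel mt \<partial>(PV \<Otimes>\<^sub>M PU))"
      using mt by (intro Z.Fubini') measurable
  qed
  also have "\<dots> = (\<integral>\<^sup>+x. \<integral>\<^sup>+mt. \<integral>\<^sup>+zt. G (mt, zt, x) \<partial>zt_kernel mt \<partial>PC \<partial>(PV \<Otimes>\<^sub>M PU))"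
  proof (rule CVU.Fubini'[symmetric])
    show "(\<lambda>(mt, x). \<integral>\<^sup>+zt. G (mt, zt, x) \<partial>zt_kernel mt) \<in> borel_measurable (PC \<Otimes>\<^sub>M PV \<Otimes>\<^sub>M PU)"
      unfolding case_prod_beta
      by (rule nn_integral_measurable_subprob_algebra2[where N=PZ]) (measurable; fail | intro kD; measurable)+
  qed
  finally show ?thesis by (simp add: G_def case_prod_beta')
qed

end

section \<open>Conditional expectations given the bits\<close>

context fl_setting
begin

lemma client_measure:
  assumes mt: "mt \<in> space PC" and i: "i < K"
  shows "prob_space (\<mu> (mt (i, b)))" and "sets (\<mu> (mt (i, b))) = sets MZ"
proof -
  have "mt (i, b) \<in> space D"
    using mt i by (auto simp: space_PiM client_idx_def)
  from measurable_space[OF \<mu> this]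
  show "prob_space (\<mu> (mt (i, b)))" and "sets (\<mu> (mt (i, b))) = sets MZ"
    by (auto simp: space_prob_algebra)
qed

lemma sample_kernel_restrict:
  "sample_kernel (\<lambda>i\<in>{..<K}. mt (i, v i))
    = (\<Pi>\<^sub>M x\<in>{..<K} \<times> {..<n}. \<mu> (mt (fst x, v (fst x))))"
  unfolding sample_kernel_def by (rule PiM_cong) auto

text \<open>With the bits fixed, selection reads distinct coordinates of the supersample, since i
  and j survive in the index. The training sample is thus an injective reindexing of a product, and
  its law is again a product.\<close>

lemma sample_index:
  defines "f \<equiv> \<lambda>v u (i, j). ((i, v i), (j, u ((i, v i), j)))"
  shows "inj_on (f v u) ({..<K} \<times> {..<n})" "f v u \<in> {..<K} \<times> {..<n} \<rightarrow> zt_idx K n"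
    and "fl_sample K n zt v u = (\<lambda>x\<in>{..<K} \<times> {..<n}. zt (f v u x))"
  by (auto simp: f_def inj_on_def zt_idx_def client_idx_def fl_sample_def fun_eq_iff restrict_def)

lemma nn_integral_zt_kernel_sample:
  assumes mt: "mt \<in> space PC" and \<phi>: "\<phi> \<in> borel_measurable PS"
  shows "(\<integral>\<^sup>+zt. \<phi> (fl_sample K n zt v u) \<partial>zt_kernel mt) = (\<integral>\<^sup>+s. \<phi> s \<partial>sample_kernel (\<lambda>i\<in>{..<K}. mt (i, v i)))"
proof -
  let ?M = "\<lambda>((i, b), _ :: nat \<times> bool). \<mu> (mt (i, b))"
  let ?f = "\<lambda>(i, j). ((i, v i), (j, u ((i, v i), j)))"
  let ?J = "{..<K} \<times> {..<n}"
  have eq: "(\<Pi>\<^sub>M x\<in>?J. ?M (?f x)) = sample_kernel (\<lambda>i\<in>{..<K}. mt (i, v i))"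
    unfolding sample_kernel_restrict by (simp add: case_prod_beta)
  have sets: "sets (\<Pi>\<^sub>M x\<in>?J. ?M (?f x)) = sets PS"
    by (intro sets_PiM_cong refl) (auto simp: client_measure(2)[OF mt])
  have meas: "(\<lambda>zt. fl_sample K n zt v u) \<in> zt_kernel mt \<rightarrow>\<^sub>M (\<Pi>\<^sub>M x\<in>?J. ?M (?f x))"
    unfolding sample_index(3) zt_kernel_def
    by (intro measurable_restrict measurable_component_singleton) (auto simp: zt_idx_def client_idx_def)
  have "distr (zt_kernel mt) (\<Pi>\<^sub>M x\<in>?J. ?M (?f x)) (\<lambda>zt. fl_sample K n zt v u) = (\<Pi>\<^sub>M x\<in>?J. ?M (?f x))"
    unfolding zt_kernel_def sample_index(3)
    by (rule distr_PiM_reindex[where M="?M" and f="?f", OF _ sample_index(1,2)])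
       (auto simp: zt_idx_def client_idx_def client_measure(1)[OF mt])
  then have "(\<integral>\<^sup>+s. \<phi> s \<partial>(\<Pi>\<^sub>M x\<in>?J. ?M (?f x)))
      = (\<integral>\<^sup>+s. \<phi> s \<partial>distr (zt_kernel mt) (\<Pi>\<^sub>M x\<in>?J. ?M (?f x)) (\<lambda>zt. fl_sample K n zt v u))"
    by simp
  also have "\<dots> = (\<integral>\<^sup>+zt. \<phi> (fl_sample K n zt v u) \<partial>zt_kernel mt)"
    by (rule nn_integral_distr[OF meas]) (simp only: measurable_distr_eq1 measurable_cong_sets[OF sets refl] \<phi>)
  finally show ?thesis unfolding eq by simp
qed

lemma nn_integral_zt_kernel_pair:
  assumes mt: "mt \<in> space PC" and \<phi>: "\<phi> \<in> borel_measurable (MZ \<Otimes>\<^sub>M PS)"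
    and ij: "i < K" "j < n" and unused: "b = v i \<Longrightarrow> c \<noteq> u ((i, v i), j)"
  shows "(\<integral>\<^sup>+zt. \<phi> (zt ((i, b), (j, c)), fl_sample K n zt v u) \<partial>zt_kernel mt)
    = (\<integral>\<^sup>+z. \<integral>\<^sup>+s. \<phi> (z, s) \<partial>sample_kernel (\<lambda>i\<in>{..<K}. mt (i, v i)) \<partial>\<mu> (mt (i, b)))"
proof -
  let ?M = "\<lambda>((i, b), _ :: nat \<times> bool). \<mu> (mt (i, b))"
  let ?f = "\<lambda>(i, j). ((i, v i), (j, u ((i, v i), j)))"
  let ?J = "{..<K} \<times> {..<n}"
  let ?x = "((i, b), (j, c))"
  let ?P = "(\<Pi>\<^sub>M x\<in>?J. ?M (?f x))"
  let ?T = "\<lambda>zt. (zt ?x, fl_sample K n zt v u)"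
  have eq: "?P = sample_kernel (\<lambda>i\<in>{..<K}. mt (i, v i))"
    unfolding sample_kernel_restrict by (simp add: case_prod_beta)
  have x: "?x \<in> zt_idx K n" "?x \<notin> ?f ` ?J"
    using ij unused by (auto simp: zt_idx_def client_idx_def)
  have sets_P: "sets ?P = sets PS"
    by (intro sets_PiM_cong refl) (auto simp: client_measure(2)[OF mt])
  have sets: "sets (?M ?x \<Otimes>\<^sub>M ?P) = sets (MZ \<Otimes>\<^sub>M PS)"
    using ij by (intro sets_pair_measure_cong sets_P) (simp add: client_measure(2)[OF mt])
  have meas: "?T \<in> zt_kernel mt \<rightarrow>\<^sub>M ?M ?x \<Otimes>\<^sub>M ?P"
    unfolding sample_index(3) zt_kernel_def using ij
    by (intro measurable_Pair measurable_restrict measurable_component_singleton) (auto simp: zt_idx_def client_idx_def)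
  have "distr (zt_kernel mt) (?M ?x \<Otimes>\<^sub>M ?P) ?T = ?M ?x \<Otimes>\<^sub>M ?P"
    unfolding zt_kernel_def sample_index(3)
    by (rule distr_PiM_pair_reindex[where M="?M" and f="?f", OF _ sample_index(1,2) x])
       (auto simp: zt_idx_def client_idx_def client_measure(1)[OF mt])
  then have "(\<integral>\<^sup>+y. \<phi> y \<partial>(?M ?x \<Otimes>\<^sub>M ?P)) = (\<integral>\<^sup>+y. \<phi> y \<partial>distr (zt_kernel mt) (?M ?x \<Otimes>\<^sub>M ?P) ?T)"
    by simp
  also have "\<dots> = (\<integral>\<^sup>+zt. \<phi> (?T zt) \<partial>zt_kernel mt)"
    by (rule nn_integral_distr[OF meas]) (simp only: measurable_distr_eq1 measurable_cong_sets[OF sets refl] \<phi>)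
  finally have *: "(\<integral>\<^sup>+zt. \<phi> (?T zt) \<partial>zt_kernel mt) = (\<integral>\<^sup>+y. \<phi> y \<partial>(?M ?x \<Otimes>\<^sub>M ?P))" ..
  interpret P: prob_space ?P
    by (intro prob_space_PiM) (auto simp: client_measure(1)[OF mt])
  have "\<phi> \<in> borel_measurable (?M ?x \<Otimes>\<^sub>M ?P)"
    unfolding measurable_cong_sets[OF sets refl] by (rule \<phi>)
  from P.nn_integral_fst[OF this] show ?thesis
    unfolding * eq[symmetric] by simp
qed

text \<open>This value and the next two cover the possible relations between a point and the
  training sample: a point of an independent client, a new point of the selected client i, and the
  training point (i, j) itself. None of them mentions the bits, so conditional expectations given
  the bits become constants.\<close>

definition test_value :: "('z \<times> (nat \<times> nat \<Rightarrow> 'z) \<Rightarrow> ennreal) \<Rightarrow> ennreal" where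
  "test_value \<phi> = (\<integral>\<^sup>+c. \<integral>\<^sup>+m. \<integral>\<^sup>+z. \<integral>\<^sup>+s. \<phi> (z, s) \<partial>sample_kernel m \<partial>\<mu> c \<partial>PiM {..<K} (\<lambda>_. D) \<partial>D)"

definition unseen_value :: "nat \<Rightarrow> ('z \<times> (nat \<times> nat \<Rightarrow> 'z) \<Rightarrow> ennreal) \<Rightarrow> ennreal" where
  "unseen_value i \<phi> = (\<integral>\<^sup>+m. \<integral>\<^sup>+z. \<integral>\<^sup>+s. \<phi> (z, s) \<partial>sample_kernel m \<partial>\<mu> (m i) \<partial>PiM {..<K} (\<lambda>_. D))"

definition train_value :: "nat \<Rightarrow> nat \<Rightarrow> ('z \<times> (nat \<times> nat \<Rightarrow> 'z) \<Rightarrow> ennreal) \<Rightarrow> ennreal" where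
  "train_value i j \<phi> = (\<integral>\<^sup>+m. \<integral>\<^sup>+s. \<phi> (s (i, j), s) \<partial>sample_kernel m \<partial>PiM {..<K} (\<lambda>_. D))"

lemma distr_clients:
  "distr PC (PiM {..<K} (\<lambda>_. D)) (\<lambda>mt. \<lambda>i\<in>{..<K}. mt (i, v i)) = PiM {..<K} (\<lambda>_. D)"
  by (rule distr_PiM_reindex) (auto simp: prob_D inj_on_def client_idx_def)

lemma measurable_clients:
  "(\<lambda>mt. \<lambda>i\<in>{..<K}. mt (i, v i)) \<in> PC \<rightarrow>\<^sub>M PiM {..<K} (\<lambda>_. D)"
  by (intro measurable_restrict measurable_component_singleton) (auto simp: client_idx_def)

text \<open>The client \<open>c\<close> of the extra point and the selected clients \<open>m\<close>
  are separate arguments: an independent \<open>c\<close> leads to the test value, and c = m i to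
  the unseen value.\<close>

lemma measurable_inner_integral[measurable]:
  assumes [measurable]: "\<phi> \<in> borel_measurable (MZ \<Otimes>\<^sub>M PS)"
  shows "(\<lambda>(c, m). \<integral>\<^sup>+z. \<integral>\<^sup>+s. \<phi> (z, s) \<partial>sample_kernel m \<partial>\<mu> c) \<in> borel_measurable (D \<Otimes>\<^sub>M PiM {..<K} (\<lambda>_. D))"
  unfolding case_prod_beta
proof (rule nn_integral_measurable_subprob_algebra2[where N=MZ])
  show "(\<lambda>(x, z). \<integral>\<^sup>+s. \<phi> (z, s) \<partial>sample_kernel (snd x)) \<in> borel_measurable ((D \<Otimes>\<^sub>M PiM {..<K} (\<lambda>_. D)) \<Otimes>\<^sub>M MZ)"
    unfolding case_prod_beta
    by (rule nn_integral_measurable_subprob_algebra2[where N=PS]) (measurable; fail | intro measurable_prob_algebraD; measurable)+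
qed (intro measurable_prob_algebraD; measurable)

text \<open>The unselected superclient (i, b) is independent of the selected ones, by the same
  extraction of a coordinate as for points. The column \<open>c\<close> is arbitrary, since no point
  of this superclient was trained on.\<close>

lemma test_value_eq:
  assumes \<phi>[measurable]: "\<phi> \<in> borel_measurable (MZ \<Otimes>\<^sub>M PS)" and ij: "i < K" "j < n" and b: "b \<noteq> v i"
  shows "(\<integral>\<^sup>+mt. \<integral>\<^sup>+zt. \<phi> (zt ((i, b), (j, c)), fl_sample K n zt v u) \<partial>zt_kernel mt \<partial>PC) = test_value \<phi>"
proof -
  let ?PM = "PiM {..<K} (\<lambda>_. D)"
  let ?T = "\<lambda>mt. (mt (i, b), \<lambda>i\<in>{..<K}. mt (i, v i))"
  interpret M: prob_space ?PM by (intro prob_space_PiM prob_D)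
  have "(\<integral>\<^sup>+mt. \<integral>\<^sup>+zt. \<phi> (zt ((i, b), (j, c)), fl_sample K n zt v u) \<partial>zt_kernel mt \<partial>PC)
      = (\<integral>\<^sup>+mt. (\<lambda>(c, m). \<integral>\<^sup>+z. \<integral>\<^sup>+s. \<phi> (z, s) \<partial>sample_kernel m \<partial>\<mu> c) (?T mt) \<partial>PC)"
  proof (intro nn_integral_cong)
    fix mt assume "mt \<in> space PC"
    from nn_integral_zt_kernel_pair[OF this \<phi> ij, of b v c u] b
    show "(\<integral>\<^sup>+zt. \<phi> (zt ((i, b), (j, c)), fl_sample K n zt v u) \<partial>zt_kernel mt)
        = (\<lambda>(c, m). \<integral>\<^sup>+z. \<integral>\<^sup>+s. \<phi> (z, s) \<partial>sample_kernel m \<partial>\<mu> c) (?T mt)"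
      by auto
  qed
  also have "\<dots> = (\<integral>\<^sup>+y. (\<lambda>(c, m). \<integral>\<^sup>+z. \<integral>\<^sup>+s. \<phi> (z, s) \<partial>sample_kernel m \<partial>\<mu> c) y \<partial>distr PC (D \<Otimes>\<^sub>M ?PM) ?T)"
    using ij by (intro nn_integral_distr[symmetric] measurable_Pair measurable_clients
        measurable_component_singleton measurable_inner_integral \<phi>) (auto simp: client_idx_def)
  also have "distr PC (D \<Otimes>\<^sub>M ?PM) ?T = D \<Otimes>\<^sub>M ?PM"
    using ij b by (intro distr_PiM_pair_reindex) (auto simp: prob_D inj_on_def client_idx_def)
  also have "(\<integral>\<^sup>+y. (\<lambda>(c, m). \<integral>\<^sup>+z. \<integral>\<^sup>+s. \<phi> (z, s) \<partial>sample_kernel m \<partial>\<mu> c) y \<partial>(D \<Otimes>\<^sub>M ?PM)) = test_value \<phi>"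
    unfolding test_value_def by (subst M.nn_integral_fst[symmetric]) (auto intro: measurable_inner_integral)
  finally show ?thesis .
qed

lemma unseen_value_eq:
  assumes \<phi>[measurable]: "\<phi> \<in> borel_measurable (MZ \<Otimes>\<^sub>M PS)" and ij: "i < K" "j < n"
    and c: "c \<noteq> u ((i, v i), j)"
  shows "(\<integral>\<^sup>+mt. \<integral>\<^sup>+zt. \<phi> (zt ((i, v i), (j, c)), fl_sample K n zt v u) \<partial>zt_kernel mt \<partial>PC) = unseen_value i \<phi>"
proof -
  let ?PM = "PiM {..<K} (\<lambda>_. D)"
  let ?T = "\<lambda>mt. \<lambda>i\<in>{..<K}. mt (i, v i)"
  let ?h = "\<lambda>m. \<integral>\<^sup>+z. \<integral>\<^sup>+s. \<phi> (z, s) \<partial>sample_kernel m \<partial>\<mu> (m i)"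
  have "(\<lambda>m. (m i, m)) \<in> ?PM \<rightarrow>\<^sub>M D \<Otimes>\<^sub>M ?PM"
    using ij by (intro measurable_Pair measurable_component_singleton measurable_ident_sets refl) auto
  from measurable_compose[OF this measurable_inner_integral[OF \<phi>]]
  have h: "?h \<in> borel_measurable ?PM" by simp
  have "(\<integral>\<^sup>+mt. \<integral>\<^sup>+zt. \<phi> (zt ((i, v i), (j, c)), fl_sample K n zt v u) \<partial>zt_kernel mt \<partial>PC)
      = (\<integral>\<^sup>+mt. ?h (?T mt) \<partial>PC)"
    using c ij by (intro nn_integral_cong) (simp add: nn_integral_zt_kernel_pair[OF _ \<phi> ij])
  also have "\<dots> = (\<integral>\<^sup>+m. ?h m \<partial>distr PC ?PM ?T)"
    by (intro nn_integral_distr[symmetric] measurable_clients) (simp add: h)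
  finally show ?thesis by (simp add: distr_clients unseen_value_def)
qed

lemma train_value_eq:
  assumes \<phi>[measurable]: "\<phi> \<in> borel_measurable (MZ \<Otimes>\<^sub>M PS)" and ij: "i < K" "j < n"
    and c: "c = u ((i, v i), j)"
  shows "(\<integral>\<^sup>+mt. \<integral>\<^sup>+zt. \<phi> (zt ((i, v i), (j, c)), fl_sample K n zt v u) \<partial>zt_kernel mt \<partial>PC) = train_value i j \<phi>"
proof -
  let ?PM = "PiM {..<K} (\<lambda>_. D)"
  let ?T = "\<lambda>mt. \<lambda>i\<in>{..<K}. mt (i, v i)"
  let ?h = "\<lambda>m. \<integral>\<^sup>+s. \<phi> (s (i, j), s) \<partial>sample_kernel m"
  have "(\<lambda>s. (s (i, j), s)) \<in> PS \<rightarrow>\<^sub>M MZ \<Otimes>\<^sub>M PS"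
    using ij by (intro measurable_Pair measurable_component_singleton measurable_ident_sets refl) auto
  note \<phi>'[measurable] = measurable_compose[OF this \<phi>]
  have h: "?h \<in> borel_measurable ?PM"
    by (rule nn_integral_measurable_subprob_algebra2[where N=PS]) (measurable; fail | intro measurable_prob_algebraD; measurable)+
  have "(\<integral>\<^sup>+mt. \<integral>\<^sup>+zt. \<phi> (zt ((i, v i), (j, c)), fl_sample K n zt v u) \<partial>zt_kernel mt \<partial>PC)
      = (\<integral>\<^sup>+mt. ?h (?T mt) \<partial>PC)"
  proof (intro nn_integral_cong)
    fix mt assume mt: "mt \<in> space PC"
    have eq: "zt ((i, v i), (j, c)) = fl_sample K n zt v u (i, j)" for zt :: "_ \<Rightarrow> 'z"
      using ij c by (simp add: fl_sample_def)
    show "(\<integral>\<^sup>+zt. \<phi> (zt ((i, v i), (j, c)), fl_sample K n zt v u) \<partial>zt_kernel mt) = ?h (?T mt)"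
      unfolding eq by (rule nn_integral_zt_kernel_sample[OF mt \<phi>'])
  qed
  also have "\<dots> = (\<integral>\<^sup>+m. ?h m \<partial>distr PC ?PM ?T)"
    by (intro nn_integral_distr[symmetric] measurable_clients) (simp add: h)
  finally show ?thesis by (simp add: distr_clients train_value_def)
qed

lemma space_zt_kernel: "mt \<in> space PC \<Longrightarrow> space (zt_kernel mt) = space PZ"
  using sets_eq_imp_space_eq[OF sets_kernel[OF measurable_prob_algebraD[OF zt_kernel]]] .

lemma fl_sample_in_space:
  assumes "zt \<in> space PZ" "v \<in> space PV" "u \<in> space PU"
  shows "fl_sample K n zt v u \<in> space PS"
  using measurable_space[OF measurable_fl_sample[of "\<lambda>_. zt" "count_space UNIV" "\<lambda>_. v" "\<lambda>_. u"]] assms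
  by auto

lemma prob_space_zt_kernel: "mt \<in> space PC \<Longrightarrow> prob_space (zt_kernel mt)"
  using measurable_space[OF zt_kernel] by (simp add: space_prob_algebra)

lemma prob_space_algorithm: "s \<in> space PS \<Longrightarrow> prob_space (A s)"
  using measurable_space[OF A] by (simp add: space_prob_algebra)

section \<open>Law of the bits under the joint measure\<close>

lemma measurable_outcome_bits:
  assumes "Measurable.pred (PV \<Otimes>\<^sub>M PU) (\<lambda>(v, u). P v u)"
  shows "Measurable.pred \<Omega> (\<lambda>(mt, zt, v, u, w). P v u)"
proof -
  have "(\<lambda>(mt, zt, v, u, w). (v, u)) \<in> \<Omega> \<rightarrow>\<^sub>M PV \<Otimes>\<^sub>M PU"
    unfolding fl_outcome_space_def by measurable
  from measurable_compose[OF this assms] show ?thesis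
    by (simp add: case_prod_beta')
qed

lemma emeasure_joint_bits:
  assumes P: "Measurable.pred (PV \<Otimes>\<^sub>M PU) (\<lambda>(v, u). P v u)"
  shows "emeasure joint {\<omega> \<in> space joint. (\<lambda>(mt, zt, v, u, w). P v u) \<omega>}
    = emeasure (PV \<Otimes>\<^sub>M PU) {x \<in> space (PV \<Otimes>\<^sub>M PU). (\<lambda>(v, u). P v u) x}"
proof -
  note P'[measurable] = measurable_outcome_bits[OF P]
  have space: "space joint = space \<Omega>" using sets_joint by (rule sets_eq_imp_space_eq)
  have "emeasure joint {\<omega> \<in> space joint. (\<lambda>(mt, zt, v, u, w). P v u) \<omega>}
      = (\<integral>\<^sup>+\<omega>. (\<lambda>(mt, zt, v, u, w). of_bool (P v u)) \<omega> \<partial>joint)"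
  proof (subst nn_integral_indicator[symmetric])
    show "{\<omega> \<in> space joint. (\<lambda>(mt, zt, v, u, w). P v u) \<omega>} \<in> sets joint"
      unfolding sets_joint space using P' by simp
  qed (rule nn_integral_cong, auto simp: indicator_def)
  also have "\<dots> = (\<integral>\<^sup>+(v, u). \<integral>\<^sup>+mt. \<integral>\<^sup>+zt. \<integral>\<^sup>+w. of_bool (P v u)
      \<partial>A (fl_sample K n zt v u) \<partial>zt_kernel mt \<partial>PC \<partial>(PV \<Otimes>\<^sub>M PU))"
    by (subst nn_integral_joint_bits_first) (use P' in \<open>auto simp: case_prod_beta'\<close>)
  also have "\<dots> = (\<integral>\<^sup>+(v, u). of_bool (P v u) \<partial>(PV \<Otimes>\<^sub>M PU))"
  proof (intro nn_integral_cong, safe)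
    fix v u assume "(v, u) \<in> space (PV \<Otimes>\<^sub>M PU)"
    then have vu: "v \<in> space PV" "u \<in> space PU" by (auto simp: space_pair_measure)
    have "(\<integral>\<^sup>+mt. \<integral>\<^sup>+zt. \<integral>\<^sup>+w. of_bool (P v u) \<partial>A (fl_sample K n zt v u) \<partial>zt_kernel mt \<partial>PC)
        = (\<integral>\<^sup>+mt. \<integral>\<^sup>+zt. of_bool (P v u) \<partial>zt_kernel mt \<partial>PC)"
      using vu by (intro nn_integral_cong)
        (simp add: space_zt_kernel fl_sample_in_space prob_space.emeasure_space_1[OF prob_space_algorithm])
    also have "\<dots> = (\<integral>\<^sup>+mt. of_bool (P v u) \<partial>PC)"
      by (intro nn_integral_cong) (simp add: prob_space.emeasure_space_1[OF prob_space_zt_kernel])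
    also have "\<dots> = of_bool (P v u)"
      by (simp add: prob_space.emeasure_space_1[OF prob_space_PC])
    finally show "(\<integral>\<^sup>+mt. \<integral>\<^sup>+zt. \<integral>\<^sup>+w. of_bool (P v u) \<partial>A (fl_sample K n zt v u) \<partial>zt_kernel mt \<partial>PC)
        = of_bool (P v u)" .
  qed
  also have "\<dots> = emeasure (PV \<Otimes>\<^sub>M PU) {x \<in> space (PV \<Otimes>\<^sub>M PU). (\<lambda>(v, u). P v u) x}"
  proof (subst nn_integral_indicator[symmetric])
    show "{x \<in> space (PV \<Otimes>\<^sub>M PU). (\<lambda>(v, u). P v u) x} \<in> sets (PV \<Otimes>\<^sub>M PU)"
      using P by simp
  qed (rule nn_integral_cong, auto simp: indicator_def)
  finally show ?thesis .
qed

lemma pred_bits[measurable]: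
  assumes "i < K" "j < n"
  shows "Measurable.pred (PV \<Otimes>\<^sub>M PU) (\<lambda>(v, u). u ((i, v i), j) = c \<and> v i = b)"
    and "Measurable.pred (PV \<Otimes>\<^sub>M PU) (\<lambda>(v, u). v i = b)"
    and "Measurable.pred (PV \<Otimes>\<^sub>M PU) (\<lambda>(v, u). u ((i, v i), j) = c)"
  unfolding case_prod_beta using assms by measurable

text \<open>Given v, the index (i, v i) is fixed, and the coin at it is fair whichever superclient
  was selected. Hence the randomly indexed bit is uniform and independent of V_i.\<close>

lemma emeasure_bits_uv:
  assumes ij: "i < K" "j < n"
  shows "emeasure (PV \<Otimes>\<^sub>M PU) {x \<in> space (PV \<Otimes>\<^sub>M PU). (\<lambda>(v, u). u ((i, v i), j) = c \<and> v i = b) x} = ennreal (1 / 4)"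
    (is "emeasure _ ?B = _")
proof -
  interpret U: prob_space PU by (rule prob_space_PU)
  have B: "?B \<in> sets (PV \<Otimes>\<^sub>M PU)" using pred_bits(1)[OF ij] by measurable
  have "emeasure (PV \<Otimes>\<^sub>M PU) ?B = (\<integral>\<^sup>+v. emeasure PU (Pair v -` ?B) \<partial>PV)"
    by (rule U.emeasure_pair_measure_alt[OF B])
  also have "\<dots> = (\<integral>\<^sup>+v. ennreal (1 / 2) * indicator {v \<in> space PV. v i = b} v \<partial>PV)"
  proof (intro nn_integral_cong)
    fix v assume v: "v \<in> space PV"
    show "emeasure PU (Pair v -` ?B) = ennreal (1 / 2) * indicator {v \<in> space PV. v i = b} v"
    proof (cases "v i = b")
      case True
      then have "Pair v -` ?B = {u \<in> space PU. u ((i, b), j) = c}"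
        using v by (auto simp: space_pair_measure)
      then show ?thesis
        using True v ij by (simp add: emeasure_PiM_coin u_idx_def client_idx_def)
    qed (use v in simp)
  qed
  also have "\<dots> = ennreal (1 / 2) * emeasure PV {v \<in> space PV. v i = b}"
    using ij by (intro nn_integral_cmult_indicator) measurable
  also have "\<dots> = ennreal (1 / 4)"
    using ij ennreal_mult[of "1 / 2" "1 / 2"] emeasure_PiM_coin[of i "{..<K}" b] by simp
  finally show ?thesis .
qed

lemma emeasure_bits:
  assumes ij: "i < K" "j < n"
  shows "emeasure (PV \<Otimes>\<^sub>M PU) {x \<in> space (PV \<Otimes>\<^sub>M PU). (\<lambda>(v, u). v i = b) x} = ennreal (1 / 2)"
    and "emeasure (PV \<Otimes>\<^sub>M PU) {x \<in> space (PV \<Otimes>\<^sub>M PU). (\<lambda>(v, u). u ((i, v i), j) = c) x} = ennreal (1 / 2)"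
proof -
  let ?B = "\<lambda>c b. {x \<in> space (PV \<Otimes>\<^sub>M PU). (\<lambda>(v, u). u ((i, v i), j) = c \<and> v i = b) x}"
  have B: "?B c b \<in> sets (PV \<Otimes>\<^sub>M PU)" for c b using pred_bits(1)[OF ij] by measurable
  have q: "ennreal (1 / 4) + ennreal (1 / 4) = ennreal (1 / 2)"
    by (subst ennreal_plus[symmetric]) auto
  have 1: "{x \<in> space (PV \<Otimes>\<^sub>M PU). (\<lambda>(v, u). v i = b) x} = ?B True b \<union> ?B False b"
    by auto
  show "emeasure (PV \<Otimes>\<^sub>M PU) {x \<in> space (PV \<Otimes>\<^sub>M PU). (\<lambda>(v, u). v i = b) x} = ennreal (1 / 2)"
  proof -
    have "?B True b \<inter> ?B False b = {}" by auto
    from plus_emeasure[OF B B this] show ?thesis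
      unfolding 1 emeasure_bits_uv[OF ij] q by (rule sym)
  qed
  have 2: "{x \<in> space (PV \<Otimes>\<^sub>M PU). (\<lambda>(v, u). u ((i, v i), j) = c) x} = ?B c True \<union> ?B c False"
    by auto
  show "emeasure (PV \<Otimes>\<^sub>M PU) {x \<in> space (PV \<Otimes>\<^sub>M PU). (\<lambda>(v, u). u ((i, v i), j) = c) x} = ennreal (1 / 2)"
  proof -
    have "?B c True \<inter> ?B c False = {}" by auto
    from plus_emeasure[OF B B this] show ?thesis
      unfolding 2 emeasure_bits_uv[OF ij] q by (rule sym)
  qed
qed

end

locale fl_loss = fl_setting D \<mu> MZ MW A K n
  for D :: "'c measure" and \<mu> :: "'c \<Rightarrow> 'z measure" and MZ and MW :: "'w measure" and A and K n +
  fixes loss :: "'w \<Rightarrow> 'z \<Rightarrow> real"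
  assumes loss[measurable]: "(\<lambda>(w, z). loss w z) \<in> borel_measurable (MW \<Otimes>\<^sub>M MZ)"
    and loss_range: "0 \<le> loss w z" "loss w z \<le> 1"
    and n_pos: "0 < n"
begin

text \<open>Expected loss at \<open>z\<close> of the hypothesis trained on \<open>s\<close>, the
  function to which the three values are applied. Keeping \<open>z\<close> and \<open>s\<close>
  separate allows \<open>z\<close> to be a fresh point or an entry of \<open>s\<close>.\<close>

definition mean_loss :: "'z \<times> (nat \<times> nat \<Rightarrow> 'z) \<Rightarrow> ennreal" where
  "mean_loss = (\<lambda>(z, s). \<integral>\<^sup>+w. ennreal (loss w z) \<partial>A s)"

lemma measurable_loss[measurable (raw)]:
  "f \<in> N \<rightarrow>\<^sub>M MW \<Longrightarrow> g \<in> N \<rightarrow>\<^sub>M MZ \<Longrightarrow> (\<lambda>x. loss (f x) (g x)) \<in> borel_measurable N"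
  using measurable_compose[OF _ loss, of "\<lambda>x. (f x, g x)" N] by simp

lemma measurable_mean_loss: "mean_loss \<in> borel_measurable (MZ \<Otimes>\<^sub>M PS)"
  unfolding mean_loss_def case_prod_beta
  by (rule nn_integral_measurable_subprob_algebra2[where N=MW])
     (measurable; fail | intro measurable_prob_algebraD; measurable)+

text \<open>With the bits outermost, the inner integral is the constant \<open>G\<close> on the
  event \<open>P\<close>, so only the probability of \<open>P\<close> remains. The index
  \<open>x v u\<close> of the evaluated point may itself depend on the bits.\<close>

lemma expectation_joint_loss:
  assumes P: "Measurable.pred (PV \<Otimes>\<^sub>M PU) (\<lambda>(v, u). P v u)"
    and meas: "(\<lambda>(mt, zt, v, u, w). loss w (zt (x v u))) \<in> borel_measurable \<Omega>"
    and val: "\<And>v u. P v u \<Longrightarrow>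
      (\<integral>\<^sup>+mt. \<integral>\<^sup>+zt. mean_loss (zt (x v u), fl_sample K n zt v u) \<partial>zt_kernel mt \<partial>PC) = G"
  shows "(\<integral>(mt, zt, v, u, w). (if P v u then loss w (zt (x v u)) else 0) \<partial>joint)
    = enn2real G * measure (PV \<Otimes>\<^sub>M PU) {y \<in> space (PV \<Otimes>\<^sub>M PU). (\<lambda>(v, u). P v u) y}"
proof -
  have F: "(\<lambda>(mt, zt, v, u, w). (if P v u then loss w (zt (x v u)) else 0)) \<in> borel_measurable \<Omega>"
  proof -
    note [measurable] = meas[unfolded case_prod_beta'] measurable_outcome_bits[OF P, unfolded case_prod_beta']
    show ?thesis unfolding case_prod_beta' by measurable
  qed
  then have F': "(\<lambda>(mt, zt, v, u, w). ennreal (if P v u then loss w (zt (x v u)) else 0)) \<in> borel_measurable \<Omega>"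
    using measurable_compose[OF F measurable_ennreal] by (simp add: case_prod_beta')
  have "(\<integral>(mt, zt, v, u, w). (if P v u then loss w (zt (x v u)) else 0) \<partial>joint)
      = enn2real (\<integral>\<^sup>+(mt, zt, v, u, w). ennreal (if P v u then loss w (zt (x v u)) else 0) \<partial>joint)"
    using F by (subst integral_eq_nn_integral)
      (auto simp: loss_range case_prod_beta' cong: measurable_cong_sets[OF sets_joint refl])
  also have "(\<integral>\<^sup>+(mt, zt, v, u, w). ennreal (if P v u then loss w (zt (x v u)) else 0) \<partial>joint)
      = (\<integral>\<^sup>+(v, u). \<integral>\<^sup>+mt. \<integral>\<^sup>+zt. \<integral>\<^sup>+w. ennreal (if P v u then loss w (zt (x v u)) else 0)
      \<partial>A (fl_sample K n zt v u) \<partial>zt_kernel mt \<partial>PC \<partial>(PV \<Otimes>\<^sub>M PU))"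
    by (subst nn_integral_joint_bits_first[OF F']) simp
  also have "\<dots> = (\<integral>\<^sup>+y. G * indicator {y \<in> space (PV \<Otimes>\<^sub>M PU). (\<lambda>(v, u). P v u) y} y \<partial>(PV \<Otimes>\<^sub>M PU))"
  proof (intro nn_integral_cong, safe)
    fix v u assume "(v, u) \<in> space (PV \<Otimes>\<^sub>M PU)"
    then show "(\<integral>\<^sup>+mt. \<integral>\<^sup>+zt. \<integral>\<^sup>+w. ennreal (if P v u then loss w (zt (x v u)) else 0)
          \<partial>A (fl_sample K n zt v u) \<partial>zt_kernel mt \<partial>PC)
        = G * indicator {y \<in> space (PV \<Otimes>\<^sub>M PU). (\<lambda>(v, u). P v u) y} (v, u)"
      using val[of v u] by (cases "P v u") (simp_all add: mean_loss_def)
  qed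
  also have "\<dots> = G * emeasure (PV \<Otimes>\<^sub>M PU) {y \<in> space (PV \<Otimes>\<^sub>M PU). (\<lambda>(v, u). P v u) y}"
    using P by (intro nn_integral_cmult_indicator) simp
  finally show ?thesis by (simp add: enn2real_mult measure_def)
qed

section \<open>The population risk as a test value\<close>

lemma client_risk_integral:
  assumes w: "w \<in> space MW" and c: "c \<in> space D"
  shows "ennreal (\<integral>z. loss w z \<partial>\<mu> c) = (\<integral>\<^sup>+z. ennreal (loss w z) \<partial>\<mu> c)"
    and "(\<integral>z. loss w z \<partial>\<mu> c) \<le> 1"
proof -
  have \<mu>c: "prob_space (\<mu> c)" "sets (\<mu> c) = sets MZ"
    using measurable_space[OF \<mu> c] by (auto simp: space_prob_algebra)
  interpret prob_space "\<mu> c" by fact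
  have "loss w \<in> borel_measurable MZ" using w by measurable
  then have "loss w \<in> borel_measurable (\<mu> c)"
    unfolding measurable_cong_sets[OF \<mu>c(2) refl] .
  then have int: "integrable (\<mu> c) (loss w)"
    by (intro integrable_const_bound[of _ 1]) (auto simp: loss_range)
  then show "ennreal (\<integral>z. loss w z \<partial>\<mu> c) = (\<integral>\<^sup>+z. ennreal (loss w z) \<partial>\<mu> c)"
    by (intro nn_integral_eq_integral[symmetric]) (auto simp: loss_range)
  show "(\<integral>z. loss w z \<partial>\<mu> c) \<le> 1"
    using integral_mono[OF int, of "\<lambda>_. 1"] by (simp add: loss_range prob_space)
qed

text \<open>Passing to nonnegative integrals makes Tonelli applicable to the population risk and
  also yields its measurability in w.\<close>

lemma ennreal_pop_risk:
  assumes w: "w \<in> space MW"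
  shows "ennreal (pop_risk D \<mu> loss w) = (\<integral>\<^sup>+c. \<integral>\<^sup>+z. ennreal (loss w z) \<partial>\<mu> c \<partial>D)"
proof -
  interpret D: prob_space D by (rule prob_D)
  have m: "(\<lambda>c. \<integral>\<^sup>+z. ennreal (loss w z) \<partial>\<mu> c) \<in> borel_measurable D"
    by (rule nn_integral_measurable_subprob_algebra2[where N=MZ, OF _ measurable_prob_algebraD[OF \<mu>]])
       (use w in measurable)
  have "(\<lambda>c. \<integral>z. loss w z \<partial>\<mu> c) \<in> borel_measurable D \<longleftrightarrow> (\<lambda>c. enn2real (\<integral>\<^sup>+z. ennreal (loss w z) \<partial>\<mu> c)) \<in> borel_measurable D"
    by (rule measurable_cong) (simp add: client_risk_integral(1)[OF w, symmetric] loss_range)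
  then have m': "(\<lambda>c. \<integral>z. loss w z \<partial>\<mu> c) \<in> borel_measurable D"
    using m by simp
  then have "integrable D (\<lambda>c. \<integral>z. loss w z \<partial>\<mu> c)"
    by (intro D.integrable_const_bound[of _ 1]) (auto simp: loss_range client_risk_integral(2)[OF w])
  then have "ennreal (pop_risk D \<mu> loss w) = (\<integral>\<^sup>+c. ennreal (\<integral>z. loss w z \<partial>\<mu> c) \<partial>D)"
    unfolding pop_risk_def by (intro nn_integral_eq_integral[symmetric]) (auto simp: loss_range)
  also have "\<dots> = (\<integral>\<^sup>+c. \<integral>\<^sup>+z. ennreal (loss w z) \<partial>\<mu> c \<partial>D)"
    by (intro nn_integral_cong client_risk_integral(1) w)
  finally show ?thesis .
qed

lemma borel_measurable_ennreal_pop_risk: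
  "(\<lambda>w. \<integral>\<^sup>+c. \<integral>\<^sup>+z. ennreal (loss w z) \<partial>\<mu> c \<partial>D) \<in> borel_measurable MW"
proof -
  interpret D: prob_space D by (rule prob_D)
  have "(\<lambda>(w, c). \<integral>\<^sup>+z. ennreal (loss w z) \<partial>\<mu> c) \<in> borel_measurable (MW \<Otimes>\<^sub>M D)"
    unfolding case_prod_beta
    by (rule nn_integral_measurable_subprob_algebra2[where N=MZ]) (measurable; fail | intro measurable_prob_algebraD; measurable)+
  then show ?thesis by measurable
qed

lemma pop_risk_nonneg: "0 \<le> pop_risk D \<mu> loss w"
  unfolding pop_risk_def by (intro Bochner_Integration.integral_nonneg) (simp add: loss_range)

lemma borel_measurable_pop_risk: "pop_risk D \<mu> loss \<in> borel_measurable MW"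
proof -
  have "pop_risk D \<mu> loss \<in> borel_measurable MW \<longleftrightarrow>
      (\<lambda>w. enn2real (\<integral>\<^sup>+c. \<integral>\<^sup>+z. ennreal (loss w z) \<partial>\<mu> c \<partial>D)) \<in> borel_measurable MW"
    by (rule measurable_cong) (simp add: ennreal_pop_risk[symmetric] pop_risk_nonneg)
  then show ?thesis using borel_measurable_ennreal_pop_risk by simp
qed

lemma nn_integral_algorithm_pop_risk:
  assumes s: "s \<in> space PS"
  shows "(\<integral>\<^sup>+w. ennreal (pop_risk D \<mu> loss w) \<partial>A s) = (\<integral>\<^sup>+c. \<integral>\<^sup>+z. mean_loss (z, s) \<partial>\<mu> c \<partial>D)"
proof -
  interpret D: prob_space D by (rule prob_D)
  interpret As: prob_space "A s" by (rule prob_space_algorithm[OF s])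
  interpret DA: pair_prob_space D "A s" ..
  note sets_A[measurable_cong] = sets_kernel[OF measurable_prob_algebraD[OF A] s]
  have "(\<integral>\<^sup>+w. ennreal (pop_risk D \<mu> loss w) \<partial>A s) = (\<integral>\<^sup>+w. \<integral>\<^sup>+c. \<integral>\<^sup>+z. ennreal (loss w z) \<partial>\<mu> c \<partial>D \<partial>A s)"
    using sets_eq_imp_space_eq[OF sets_A] by (intro nn_integral_cong ennreal_pop_risk) simp
  also have "\<dots> = (\<integral>\<^sup>+c. \<integral>\<^sup>+w. \<integral>\<^sup>+z. ennreal (loss w z) \<partial>\<mu> c \<partial>A s \<partial>D)"
  proof (rule DA.Fubini')
    show "(\<lambda>(c, w). \<integral>\<^sup>+z. ennreal (loss w z) \<partial>\<mu> c) \<in> borel_measurable (D \<Otimes>\<^sub>M A s)"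
      unfolding case_prod_beta
      by (rule nn_integral_measurable_subprob_algebra2[where N=MZ]) (measurable; fail | intro measurable_prob_algebraD; measurable)+
  qed
  also have "\<dots> = (\<integral>\<^sup>+c. \<integral>\<^sup>+z. mean_loss (z, s) \<partial>\<mu> c \<partial>D)"
  proof (intro nn_integral_cong)
    fix c assume c: "c \<in> space D"
    have \<mu>c: "prob_space (\<mu> c)" and sets_\<mu>[measurable_cong]: "sets (\<mu> c) = sets MZ"
      using measurable_space[OF \<mu> c] by (auto simp: space_prob_algebra)
    interpret C: prob_space "\<mu> c" by fact
    interpret CA: pair_prob_space "\<mu> c" "A s" ..
    show "(\<integral>\<^sup>+w. \<integral>\<^sup>+z. ennreal (loss w z) \<partial>\<mu> c \<partial>A s) = (\<integral>\<^sup>+z. mean_loss (z, s) \<partial>\<mu> c)"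
      unfolding mean_loss_def prod.case by (rule CA.Fubini') measurable
  qed
  finally show ?thesis .
qed

text \<open>The fresh client and its point are drawn independently of the selected clients and the
  sample, so their integrals can be moved innermost. At a fixed sample these then give the mean
  population risk of the output.\<close>

lemma test_value_swap:
  assumes \<phi>[measurable]: "\<phi> \<in> borel_measurable (MZ \<Otimes>\<^sub>M PS)"
  shows "test_value \<phi> = (\<integral>\<^sup>+m. \<integral>\<^sup>+s. \<integral>\<^sup>+c. \<integral>\<^sup>+z. \<phi> (z, s) \<partial>\<mu> c \<partial>D \<partial>sample_kernel m \<partial>PiM {..<K} (\<lambda>_. D))"
proof -
  interpret D: prob_space D by (rule prob_D)
  interpret M: prob_space "PiM {..<K} (\<lambda>_. D)" by (intro prob_space_PiM prob_D)
  interpret DM: pair_prob_space D "PiM {..<K} (\<lambda>_. D)" ..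
  have "test_value \<phi> = (\<integral>\<^sup>+m. \<integral>\<^sup>+c. \<integral>\<^sup>+z. \<integral>\<^sup>+s. \<phi> (z, s) \<partial>sample_kernel m \<partial>\<mu> c \<partial>D \<partial>PiM {..<K} (\<lambda>_. D))"
    unfolding test_value_def by (rule DM.Fubini'[symmetric]) (rule measurable_inner_integral[OF \<phi>])
  also have "\<dots> = (\<integral>\<^sup>+m. \<integral>\<^sup>+s. \<integral>\<^sup>+c. \<integral>\<^sup>+z. \<phi> (z, s) \<partial>\<mu> c \<partial>D \<partial>sample_kernel m \<partial>PiM {..<K} (\<lambda>_. D))"
  proof (intro nn_integral_cong)
    fix m assume m: "m \<in> space (PiM {..<K} (\<lambda>_. D))"
    interpret S: prob_space "sample_kernel m"
      using measurable_space[OF sample_kernel m] by (simp add: space_prob_algebra)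
    have sets_S[measurable_cong]: "sets (sample_kernel m) = sets PS"
      using measurable_space[OF sample_kernel m] by (simp add: space_prob_algebra)
    interpret DS: pair_prob_space D "sample_kernel m" ..
    have "(\<integral>\<^sup>+c. \<integral>\<^sup>+z. \<integral>\<^sup>+s. \<phi> (z, s) \<partial>sample_kernel m \<partial>\<mu> c \<partial>D) = (\<integral>\<^sup>+c. \<integral>\<^sup>+s. \<integral>\<^sup>+z. \<phi> (z, s) \<partial>\<mu> c \<partial>sample_kernel m \<partial>D)"
    proof (intro nn_integral_cong)
      fix c assume c: "c \<in> space D"
      have \<mu>c: "prob_space (\<mu> c)" and sets_\<mu>[measurable_cong]: "sets (\<mu> c) = sets MZ"
        using measurable_space[OF \<mu> c] by (auto simp: space_prob_algebra)
      interpret C: prob_space "\<mu> c" by fact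
      interpret CS: pair_prob_space "\<mu> c" "sample_kernel m" ..
      show "(\<integral>\<^sup>+z. \<integral>\<^sup>+s. \<phi> (z, s) \<partial>sample_kernel m \<partial>\<mu> c) = (\<integral>\<^sup>+s. \<integral>\<^sup>+z. \<phi> (z, s) \<partial>\<mu> c \<partial>sample_kernel m)"
        by (rule CS.Fubini'[symmetric]) measurable
    qed
    also have "\<dots> = (\<integral>\<^sup>+s. \<integral>\<^sup>+c. \<integral>\<^sup>+z. \<phi> (z, s) \<partial>\<mu> c \<partial>D \<partial>sample_kernel m)"
    proof (rule DS.Fubini'[symmetric])
      show "(\<lambda>(c, s). \<integral>\<^sup>+z. \<phi> (z, s) \<partial>\<mu> c) \<in> borel_measurable (D \<Otimes>\<^sub>M sample_kernel m)"
        unfolding case_prod_beta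
        by (rule nn_integral_measurable_subprob_algebra2[where N=MZ]) (measurable; fail | intro measurable_prob_algebraD; measurable)+
    qed
    finally show "(\<integral>\<^sup>+c. \<integral>\<^sup>+z. \<integral>\<^sup>+s. \<phi> (z, s) \<partial>sample_kernel m \<partial>\<mu> c \<partial>D)
        = (\<integral>\<^sup>+s. \<integral>\<^sup>+c. \<integral>\<^sup>+z. \<phi> (z, s) \<partial>\<mu> c \<partial>D \<partial>sample_kernel m)" .
  qed
  finally show ?thesis .
qed

text \<open>With the bits fixed, the population risk of the output sees the supersample only through
  the training sample, whose law is the same for all bits; the outer integral is over a
  constant.\<close>

lemma expectation_pop_risk:
  "(\<integral>(mt, zt, v, u, w). pop_risk D \<mu> loss w \<partial>joint) = enn2real (test_value mean_loss)"
proof -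
  define \<psi> where "\<psi> s = (\<integral>\<^sup>+c. \<integral>\<^sup>+z. mean_loss (z, s) \<partial>\<mu> c \<partial>D)" for s
  interpret D: prob_space D by (rule prob_D)
  note [measurable] = borel_measurable_pop_risk measurable_mean_loss
  have "(\<lambda>(s, c). \<integral>\<^sup>+z. mean_loss (z, s) \<partial>\<mu> c) \<in> borel_measurable (PS \<Otimes>\<^sub>M D)"
    unfolding case_prod_beta
    by (rule nn_integral_measurable_subprob_algebra2[where N=MZ]) (measurable; fail | intro measurable_prob_algebraD; measurable)+
  then have \<psi>[measurable]: "\<psi> \<in> borel_measurable PS"
    unfolding \<psi>_def[abs_def] by measurable
  have \<psi>': "(\<lambda>m. \<integral>\<^sup>+s. \<psi> s \<partial>sample_kernel m) \<in> borel_measurable (PiM {..<K} (\<lambda>_. D))"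
    by (rule nn_integral_measurable_subprob_algebra2[where N=PS]) (measurable; fail | intro measurable_prob_algebraD; measurable)+
  have F[measurable]: "(\<lambda>(mt, zt, v, u, w). pop_risk D \<mu> loss w) \<in> borel_measurable \<Omega>"
    unfolding fl_outcome_space_def by measurable
  have F': "(\<lambda>(mt, zt, v, u, w). ennreal (pop_risk D \<mu> loss w)) \<in> borel_measurable \<Omega>"
    unfolding fl_outcome_space_def by measurable
  have "(\<integral>(mt, zt, v, u, w). pop_risk D \<mu> loss w \<partial>joint)
      = enn2real (\<integral>\<^sup>+(mt, zt, v, u, w). ennreal (pop_risk D \<mu> loss w) \<partial>joint)"
    using F by (subst integral_eq_nn_integral)
      (auto simp: pop_risk_nonneg case_prod_beta' measurable_cong_sets[OF sets_joint refl])
  also have "(\<integral>\<^sup>+(mt, zt, v, u, w). ennreal (pop_risk D \<mu> loss w) \<partial>joint)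
      = (\<integral>\<^sup>+(v, u). \<integral>\<^sup>+mt. \<integral>\<^sup>+zt. \<integral>\<^sup>+w. ennreal (pop_risk D \<mu> loss w)
      \<partial>A (fl_sample K n zt v u) \<partial>zt_kernel mt \<partial>PC \<partial>(PV \<Otimes>\<^sub>M PU))"
    by (subst nn_integral_joint_bits_first[OF F']) simp
  also have "\<dots> = (\<integral>\<^sup>+(v, u). test_value mean_loss \<partial>(PV \<Otimes>\<^sub>M PU))"
  proof (intro nn_integral_cong, safe)
    fix v u assume "(v, u) \<in> space (PV \<Otimes>\<^sub>M PU)"
    then have vu: "v \<in> space PV" "u \<in> space PU" by (auto simp: space_pair_measure)
    let ?T = "\<lambda>mt. \<lambda>i\<in>{..<K}. mt (i, v i)"
    have "(\<integral>\<^sup>+mt. \<integral>\<^sup>+zt. \<integral>\<^sup>+w. ennreal (pop_risk D \<mu> loss w) \<partial>A (fl_sample K n zt v u) \<partial>zt_kernel mt \<partial>PC)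
        = (\<integral>\<^sup>+mt. \<integral>\<^sup>+zt. \<psi> (fl_sample K n zt v u) \<partial>zt_kernel mt \<partial>PC)"
      unfolding \<psi>_def using vu
      by (intro nn_integral_cong nn_integral_algorithm_pop_risk fl_sample_in_space) (simp_all add: space_zt_kernel)
    also have "\<dots> = (\<integral>\<^sup>+mt. \<integral>\<^sup>+s. \<psi> s \<partial>sample_kernel (?T mt) \<partial>PC)"
      by (intro nn_integral_cong nn_integral_zt_kernel_sample \<psi>)
    also have "\<dots> = (\<integral>\<^sup>+m. \<integral>\<^sup>+s. \<psi> s \<partial>sample_kernel m \<partial>distr PC (PiM {..<K} (\<lambda>_. D)) ?T)"
      by (intro nn_integral_distr[symmetric] measurable_clients) (simp add: \<psi>')
    also have "\<dots> = test_value mean_loss"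
      by (simp add: distr_clients test_value_swap[OF measurable_mean_loss] \<psi>_def)
    finally show "(\<integral>\<^sup>+mt. \<integral>\<^sup>+zt. \<integral>\<^sup>+w. ennreal (pop_risk D \<mu> loss w) \<partial>A (fl_sample K n zt v u) \<partial>zt_kernel mt \<partial>PC)
        = test_value mean_loss" .
  qed
  also have "\<dots> = test_value mean_loss"
  proof -
    interpret V: prob_space PV by (rule prob_space_PV)
    interpret U: prob_space PU by (rule prob_space_PU)
    interpret VU: pair_prob_space PV PU ..
    show ?thesis by (simp add: case_prod_beta' VU.emeasure_space_1)
  qed
  finally show ?thesis .
qed

section \<open>Test, unseen and training risks as expectations split by a bit\<close>

definition "test_risk = enn2real (test_value mean_loss)"
definition "unseen_risk i = enn2real (unseen_value i mean_loss)"
definition "train_risk i j = enn2real (train_value i j mean_loss)"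

lemma measurable_loss_lookup:
  assumes "i < K" "j < n"
  shows "(\<lambda>(mt, zt, v, u, w). loss w (zt ((i, False), (j, \<not> u ((i, False), j))))) \<in> borel_measurable \<Omega>"
    and "(\<lambda>(mt, zt, v, u, w). loss w (zt ((i, v i), (j, False)))) \<in> borel_measurable \<Omega>"
    and "(\<lambda>(mt, zt, v, u, w). loss w (zt ((i, v i), (j, u ((i, v i), j))))) \<in> borel_measurable \<Omega>"
  unfolding fl_outcome_space_def using assms by measurable

lemma measurable_joint_iff: "f \<in> joint \<rightarrow>\<^sub>M N \<longleftrightarrow> f \<in> \<Omega> \<rightarrow>\<^sub>M N"
  by (simp add: measurable_cong_sets[OF sets_joint refl])

lemma integrable_joint_loss:
  assumes P: "Measurable.pred (PV \<Otimes>\<^sub>M PU) (\<lambda>(v, u). P v u)"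
    and meas: "(\<lambda>(mt, zt, v, u, w). loss w (zt (x v u))) \<in> borel_measurable \<Omega>"
  shows "integrable joint (\<lambda>(mt, zt, v, u, w). (if P v u then loss w (zt (x v u)) else 0))"
proof -
  interpret prob_space joint by (rule prob_space_joint)
  note [measurable] = meas[unfolded case_prod_beta'] measurable_outcome_bits[OF P, unfolded case_prod_beta']
  show ?thesis
    by (intro integrable_const_bound[of _ 1])
       (auto simp: loss_range case_prod_beta' measurable_joint_iff)
qed

lemma measure_bits:
  assumes ij: "i < K" "j < n"
  shows "measure (PV \<Otimes>\<^sub>M PU) {x \<in> space (PV \<Otimes>\<^sub>M PU). (\<lambda>(v, u). v i = b) x} = 1 / 2"
    and "measure (PV \<Otimes>\<^sub>M PU) {x \<in> space (PV \<Otimes>\<^sub>M PU). (\<lambda>(v, u). u ((i, v i), j) = c) x} = 1 / 2"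
  by (rule measure_eq_emeasure_eq_ennreal[OF _ emeasure_bits(1)[OF ij]], simp)
     (rule measure_eq_emeasure_eq_ennreal[OF _ emeasure_bits(2)[OF ij]], simp)

text \<open>Superclient (i, False) participates exactly when the bit v i is False, and the column is
  the one its own bit leaves out. So the point is new in both cases, and the bit only decides
  whether its client took part. Points are numbered from 0, hence index 0 for the first one.\<close>

lemma expectation_unseen_client:
  assumes i: "i < K"
  shows "(\<integral>(mt, zt, v, u, w). (if v i = b then loss w (zt ((i, False), (0, \<not> u ((i, False), 0)))) else 0) \<partial>joint)
    = (if b then test_risk else unseen_risk i) / 2"
proof -
  have "(\<integral>\<^sup>+mt. \<integral>\<^sup>+zt. mean_loss (zt ((i, False), (0, \<not> u ((i, False), 0))), fl_sample K n zt v u) \<partial>zt_kernel mt \<partial>PC)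
      = (if b then test_value mean_loss else unseen_value i mean_loss)" if "v i = b" for v u
  proof (cases b)
    case True
    then show ?thesis
      using that test_value_eq[OF measurable_mean_loss i n_pos, of False v] by simp
  next
    case False
    then show ?thesis
      using that unseen_value_eq[OF measurable_mean_loss i n_pos, of "\<not> u ((i, False), 0)" u v] by simp
  qed
  from expectation_joint_loss[OF pred_bits(2)[OF i n_pos, of b] measurable_loss_lookup(1)[OF i n_pos] this]
  show ?thesis
    unfolding measure_bits(1)[OF i n_pos]
    by (simp add: test_risk_def unseen_risk_def)
qed

text \<open>In the selected superclient the bit names the column used for training. The fixed column
  False therefore holds the training point when the bit is False, and its unseen partner when the
  bit is True.\<close>

lemma expectation_training_bit:
  assumes i: "i < K" and j: "j < n"
  shows "(\<integral>(mt, zt, v, u, w). (if u ((i, v i), j) = b then loss w (zt ((i, v i), (j, False))) else 0) \<partial>joint)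
    = (if b then unseen_risk i else train_risk i j) / 2"
proof -
  have "(\<integral>\<^sup>+mt. \<integral>\<^sup>+zt. mean_loss (zt ((i, v i), (j, False)), fl_sample K n zt v u) \<partial>zt_kernel mt \<partial>PC)
      = (if b then unseen_value i mean_loss else train_value i j mean_loss)" if "u ((i, v i), j) = b" for v u
  proof (cases b)
    case True
    then show ?thesis
      using that unseen_value_eq[OF measurable_mean_loss i j, of False u v] by simp
  next
    case False
    then show ?thesis
      using that train_value_eq[OF measurable_mean_loss i j, of False u v] by simp
  qed
  from expectation_joint_loss[OF pred_bits(3)[OF i j, of b] measurable_loss_lookup(2)[OF i j] this]
  show ?thesis
    unfolding measure_bits(2)[OF i j]
    by (simp add: train_risk_def unseen_risk_def)
qed

lemma expectation_emp_risk:
  "(\<integral>(mt, zt, v, u, w). emp_risk K n loss w (fl_sample K n zt v u) \<partial>joint)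
    = (1 / (real K * real n)) * (\<Sum>i<K. \<Sum>j<n. train_risk i j)"
proof -
  interpret V: prob_space PV by (rule prob_space_PV)
  interpret U: prob_space PU by (rule prob_space_PU)
  interpret VU: pair_prob_space PV PU ..
  let ?l = "\<lambda>i j. \<lambda>(mt, zt, v, u, w). loss w (zt ((i, v i), (j, u ((i, v i), j))))"
  have T: "Measurable.pred (PV \<Otimes>\<^sub>M PU) (\<lambda>(v, u). True)" by simp
  have l: "(\<integral>x. ?l i j x \<partial>joint) = train_risk i j" "integrable joint (?l i j)" if "i < K" "j < n" for i j
    using expectation_joint_loss[OF T measurable_loss_lookup(3)[OF that] train_value_eq[OF measurable_mean_loss that refl]]
      integrable_joint_loss[OF T measurable_loss_lookup(3)[OF that]]
    by (simp_all add: train_risk_def case_prod_beta' VU.prob_space)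
  have "(\<integral>(mt, zt, v, u, w). emp_risk K n loss w (fl_sample K n zt v u) \<partial>joint)
      = (\<integral>x. (1 / (real K * real n)) * (\<Sum>i<K. \<Sum>j<n. ?l i j x) \<partial>joint)"
    by (intro Bochner_Integration.integral_cong refl)
       (auto simp: emp_risk_def fl_sample_def case_prod_beta' intro!: sum.cong)
  also have "\<dots> = (1 / (real K * real n)) * (\<Sum>i<K. \<Sum>j<n. train_risk i j)"
  proof -
    have "(\<integral>x. (\<Sum>i<K. \<Sum>j<n. ?l i j x) \<partial>joint) = (\<Sum>i<K. \<integral>x. (\<Sum>j<n. ?l i j x) \<partial>joint)"
      by (intro Bochner_Integration.integral_sum Bochner_Integration.integrable_sum l(2)) auto
    also have "\<dots> = (\<Sum>i<K. \<Sum>j<n. \<integral>x. ?l i j x \<partial>joint)"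
      by (intro sum.cong refl Bochner_Integration.integral_sum l(2)) auto
    finally show ?thesis by (simp add: l(1))
  qed
  finally show ?thesis .
qed

lemma prob_v:
  assumes "i < K"
  shows "measure joint {\<omega> \<in> space joint. (\<lambda>(mt, zt, v, u, w). v i) \<omega> = b} = 1 / 2"
proof (rule measure_eq_emeasure_eq_ennreal)
  show "emeasure joint {\<omega> \<in> space joint. (\<lambda>(mt, zt, v, u, w). v i) \<omega> = b} = ennreal (1 / 2)"
    using emeasure_joint_bits[OF pred_bits(2)[OF assms n_pos, of b]] emeasure_bits(1)[OF assms n_pos, of b]
    by (simp only: case_prod_beta')
qed simp

lemma prob_uv:
  assumes "i < K" "j < n"
  shows "measure joint {\<omega> \<in> space joint. (\<lambda>(mt, zt, v, u, w). u ((i, v i), j)) \<omega> = c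
    \<and> (\<lambda>(mt, zt, v, u, w). v i) \<omega> = b} = 1 / 4"
proof (rule measure_eq_emeasure_eq_ennreal)
  show "emeasure joint {\<omega> \<in> space joint. (\<lambda>(mt, zt, v, u, w). u ((i, v i), j)) \<omega> = c
      \<and> (\<lambda>(mt, zt, v, u, w). v i) \<omega> = b} = ennreal (1 / 4)"
    using emeasure_joint_bits[OF pred_bits(1)[OF assms, of c b]] emeasure_bits_uv[OF assms, of c b]
    by (simp only: case_prod_beta')
qed simp

lemma measurable_joint_bit:
  assumes "i < K" "j < n"
  shows "(\<lambda>(mt, zt, v, u, w). v i) \<in> joint \<rightarrow>\<^sub>M count_space UNIV"
    and "(\<lambda>(mt, zt, v, u, w). u ((i, v i), j)) \<in> joint \<rightarrow>\<^sub>M count_space UNIV"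
  unfolding measurable_joint_iff fl_outcome_space_def using assms by measurable

section \<open>Bounding the two gaps by mutual information\<close>

lemma client_gap:
  fixes C1 C3 :: real
  assumes i: "i < K" and C: "1 < C1" "0 < C3" and exp_le: "exp (- 2 * C3 * C1) + exp (2 * C3) \<le> 2"
  shows "C3 * (test_risk - C1 * unseen_risk i) \<le> prob_space.mutual_information joint (exp 1)
    borel (count_space UNIV)
    (\<lambda>(mt, zt, v, u, w). loss w (zt ((i, False), (0, \<not> u ((i, False), 0)))))
    (\<lambda>(mt, zt, v, u, w). v i)"
    (is "_ \<le> prob_space.mutual_information _ _ _ _ ?X ?Y")
proof -
  interpret prob_space joint by (rule prob_space_joint)
  \<comment> \<open>The 2 cancels the probability 1/2 of each bit value, and C3 scales the contrast
    to the exponents of the assumption. Cutting the loss off to [0,1] changes none of its values but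
    makes the bounds on \<open>f\<close> and on the mean of \<open>exp f\<close> valid on all reals,
    as the variational inequality requires.\<close>
  define f :: "real \<times> bool \<Rightarrow> real" where
    "f = (\<lambda>(l, b). (if b then 2 * C3 else - 2 * C3 * C1) * max 0 (min 1 l))"
  let ?I = "\<lambda>b. \<lambda>(mt, zt, v, u, w). if v i = b then loss w (zt ((i, False), (0, \<not> u ((i, False), 0)))) else 0"
  have int: "integrable joint (?I b)" for b
    by (rule integrable_joint_loss[OF pred_bits(2)[OF i n_pos] measurable_loss_lookup(1)[OF i n_pos]])
  have "expectation (\<lambda>\<omega>. f (?X \<omega>, ?Y \<omega>)) = (\<integral>\<omega>. 2 * C3 * ?I True \<omega> - 2 * C3 * C1 * ?I False \<omega> \<partial>joint)"
    by (intro Bochner_Integration.integral_cong refl) (auto simp: f_def loss_range)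
  also have "\<dots> = 2 * C3 * (\<integral>\<omega>. ?I True \<omega> \<partial>joint) - 2 * C3 * C1 * (\<integral>\<omega>. ?I False \<omega> \<partial>joint)"
    by (rule integral_diff_scaled[OF int[of True] int[of False]])
  also have "\<dots> = C3 * (test_risk - C1 * unseen_risk i)"
    using expectation_unseen_client[OF i, of True] expectation_unseen_client[OF i, of False]
    by (simp add: algebra_simps)
  finally have E: "expectation (\<lambda>\<omega>. f (?X \<omega>, ?Y \<omega>)) = C3 * (test_risk - C1 * unseen_risk i)" .
  show ?thesis
    unfolding E[symmetric]
  proof (rule expectation_le_mutual_information)
    show "?X \<in> joint \<rightarrow>\<^sub>M borel" "?Y \<in> joint \<rightarrow>\<^sub>M count_space UNIV"
      using measurable_loss_lookup(1)[OF i n_pos] measurable_joint_bit(1)[OF i n_pos]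
      by (simp_all add: measurable_joint_iff)
    show "f \<in> borel_measurable (borel \<Otimes>\<^sub>M count_space UNIV)"
      unfolding f_def by measurable
    show "\<bar>f x\<bar> \<le> 2 * C3 * C1" for x
    proof -
      have "\<bar>f x\<bar> \<le> (2 * C3 * C1) * 1"
        unfolding f_def case_prod_beta abs_mult using C by (intro mult_mono) auto
      then show ?thesis by simp
    qed
    show "(\<Sum>y\<in>UNIV. prob {\<omega> \<in> space joint. ?Y \<omega> = y} * exp (f (x, y))) \<le> 1" for x
      unfolding prob_v[OF i]
      using exp_contrast_mean_le[OF exp_le, of "max 0 (min 1 x)"] by (simp add: UNIV_bool f_def)
  qed (unfold prob_v[OF i], simp)
qed

lemma sample_gap:
  fixes C2 C4 :: real
  assumes i: "i < K" and j: "j < n" and C: "1 < C2" "0 < C4"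
    and exp_le: "exp (- 2 * C4 * C2) + exp (2 * C4) \<le> 2"
  shows "C4 * (unseen_risk i - C2 * train_risk i j) \<le> prob_space.conditional_mutual_information joint (exp 1)
    borel (count_space UNIV) (count_space UNIV)
    (\<lambda>(mt, zt, v, u, w). loss w (zt ((i, v i), (j, False))))
    (\<lambda>(mt, zt, v, u, w). u ((i, v i), j))
    (\<lambda>(mt, zt, v, u, w). v i)"
    (is "_ \<le> prob_space.conditional_mutual_information _ _ _ _ _ ?X ?Y ?Z")
proof -
  interpret prob_space joint by (rule prob_space_joint)
  \<comment> \<open>The third argument is ignored: given V_i, the training bit is still fair, so one
    contrast serves for both selected superclients.\<close>
  define f :: "real \<times> bool \<times> bool \<Rightarrow> real" where
    "f = (\<lambda>(l, b, _). (if b then 2 * C4 else - 2 * C4 * C2) * max 0 (min 1 l))"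
  let ?I = "\<lambda>b. \<lambda>(mt, zt, v, u, w). if u ((i, v i), j) = b then loss w (zt ((i, v i), (j, False))) else 0"
  have int: "integrable joint (?I b)" for b
    by (rule integrable_joint_loss[OF pred_bits(3)[OF i j] measurable_loss_lookup(2)[OF i j]])
  have "expectation (\<lambda>\<omega>. f (?X \<omega>, ?Y \<omega>, ?Z \<omega>)) = (\<integral>\<omega>. 2 * C4 * ?I True \<omega> - 2 * C4 * C2 * ?I False \<omega> \<partial>joint)"
    by (intro Bochner_Integration.integral_cong refl) (auto simp: f_def loss_range)
  also have "\<dots> = 2 * C4 * (\<integral>\<omega>. ?I True \<omega> \<partial>joint) - 2 * C4 * C2 * (\<integral>\<omega>. ?I False \<omega> \<partial>joint)"
    by (rule integral_diff_scaled[OF int[of True] int[of False]])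
  also have "\<dots> = C4 * (unseen_risk i - C2 * train_risk i j)"
    using expectation_training_bit[OF i j, of True] expectation_training_bit[OF i j, of False]
    by (simp add: algebra_simps)
  finally have E: "expectation (\<lambda>\<omega>. f (?X \<omega>, ?Y \<omega>, ?Z \<omega>)) = C4 * (unseen_risk i - C2 * train_risk i j)" .
  show ?thesis
    unfolding E[symmetric]
  proof (rule expectation_le_conditional_mutual_information)
    show "?X \<in> joint \<rightarrow>\<^sub>M borel" "?Y \<in> joint \<rightarrow>\<^sub>M count_space UNIV" "?Z \<in> joint \<rightarrow>\<^sub>M count_space UNIV"
      using measurable_loss_lookup(2)[OF i j] measurable_joint_bit[OF i j]
      by (simp_all add: measurable_joint_iff)
    have eq: "count_space UNIV \<Otimes>\<^sub>M count_space UNIV = count_space (UNIV :: (bool \<times> bool) set)"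
      by (simp add: pair_measure_count_space)
    show "f \<in> borel_measurable (borel \<Otimes>\<^sub>M count_space UNIV)"
      unfolding f_def eq[symmetric] by measurable
    show "\<bar>f x\<bar> \<le> 2 * C4 * C2" for x
    proof -
      have "\<bar>f x\<bar> \<le> (2 * C4 * C2) * 1"
        unfolding f_def case_prod_beta abs_mult using C by (intro mult_mono) auto
      then show ?thesis by simp
    qed
    show "(\<Sum>y\<in>UNIV. prob {\<omega> \<in> space joint. ?Y \<omega> = y \<and> ?Z \<omega> = z} * exp (f (x, y, z)))
        \<le> prob {\<omega> \<in> space joint. ?Z \<omega> = z}" for x z
    proof -
      \<comment> \<open>Each pair of bit values has probability 1/4, and twice this is the
        probability 1/2 of Z = z on the right.\<close>
      have "(\<Sum>y\<in>UNIV. 1 / 4 * exp (f (x, y, z))) = 1 / 4 * (exp (f (x, False, z)) + exp (f (x, True, z)))"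
        by (simp add: UNIV_bool)
      also have "\<dots> \<le> 1 / 4 * 2"
        unfolding f_def prod.case if_True if_False
        by (intro mult_left_mono exp_contrast_mean_le[OF exp_le]) auto
      finally show ?thesis
        unfolding prob_uv[OF i j] prob_v[OF i] by simp
    qed
  qed (unfold prob_uv[OF i j], simp)
qed

end

theorem theorem4:
  fixes D :: "'c measure" and \<mu> :: "'c \<Rightarrow> 'z measure" and MZ :: "'z measure"
    and MW :: "'w measure" and A :: "(nat \<times> nat \<Rightarrow> 'z) \<Rightarrow> 'w measure"
    and loss :: "'w \<Rightarrow> 'z \<Rightarrow> real" and K n :: nat and C1 C2 C3 C4 :: real
  assumes "prob_space D"
    and "\<mu> \<in> D \<rightarrow>\<^sub>M prob_algebra MZ"
    and "A \<in> PiM ({..<K} \<times> {..<n}) (\<lambda>_. MZ) \<rightarrow>\<^sub>M prob_algebra MW"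
    and "(\<lambda>(w, z). loss w z) \<in> borel_measurable (MW \<Otimes>\<^sub>M MZ)"
    and "\<forall>w z. 0 \<le> loss w z \<and> loss w z \<le> 1"
    and "0 < K" and "0 < n"
    and "1 < C1" and "1 < C2" and "0 < C3" and "0 < C4"
    and "exp (- 2 * C3 * C1) + exp (2 * C3) \<le> 2"
    and "exp (- 2 * C4 * C2) + exp (2 * C4) \<le> 2"
  shows "(\<integral>(mt, zt, v, u, w). pop_risk D \<mu> loss w \<partial>(fl_joint D \<mu> MZ MW A K n))
    \<le> C1 * C2 * (\<integral>(mt, zt, v, u, w). emp_risk K n loss w (fl_sample K n zt v u) \<partial>(fl_joint D \<mu> MZ MW A K n))
      + (\<Sum>i<K. prob_space.mutual_information (fl_joint D \<mu> MZ MW A K n) (exp 1)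
             borel (count_space UNIV)
             (\<lambda>(mt, zt, v, u, w). loss w (zt ((i, False), (0, \<not> u ((i, False), 0)))))
             (\<lambda>(mt, zt, v, u, w). v i)
           / (C3 * real K))
      + (\<Sum>i<K. \<Sum>j<n. C1 * prob_space.conditional_mutual_information (fl_joint D \<mu> MZ MW A K n) (exp 1)
             borel (count_space UNIV) (count_space UNIV)
             (\<lambda>(mt, zt, v, u, w). loss w (zt ((i, v i), (j, False))))
             (\<lambda>(mt, zt, v, u, w). u ((i, v i), j))
             (\<lambda>(mt, zt, v, u, w). v i)
           / (C4 * real K * real n))"
proof -
  interpret fl_loss D \<mu> MZ MW A K n loss
    by (intro fl_loss.intro fl_setting.intro fl_loss_axioms.intro)
       (use assms in \<open>blast+\<close>)
  show ?thesis
    unfolding expectation_pop_risk expectation_emp_risk test_risk_def[symmetric]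
  \<comment> \<open>The unseen risk is the intermediate quantity between test and training risk. It
    is eliminated from the conclusion, so it has to be supplied.\<close>
  proof (rule average_gap_bound[where U=unseen_risk])
    show "0 < K" "0 < n" "0 < C3" "0 < C4" by fact+
    show "0 \<le> C1" using assms(8) by simp
  qed (rule client_gap[OF _ assms(8,10,12)] sample_gap[OF _ _ assms(9,11,13)]; assumption)+
qed

end
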